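(* Let $\alpha\in(1,\infty)$ and let $\mathcal N,\mathcal M$ be completely positive maps from $\mathscr L(X')$ to $\mathscr L(Y)$, with $X$ a copy of $X'$. Then $D^{\#}_\alpha(\mathcal N\|\mathcal M)=\frac{1}{\alpha-1}\log_2 Q^{\#}_\alpha(\mathcal N\|\mathcal M)$ where $$Q^{\#}_\alpha(\mathcal N\|\mathcal M):=\sup_{\omega\in\mathscr D(X)}Q^{\#}_\alpha\big(\omega^{1/2}J^{\mathcal N}_{XY}\omega^{1/2}\,\big\|\,\omega^{1/2}J^{\mathcal M}_{XY}\omega^{1/2}\big)=\inf\Big\{\|\mathrm{tr}_Y(A_{XY})\|_\infty : A_{XY}\ge0,\ J^{\mathcal N}_{XY}\le J^{\mathcal M}_{XY}\#_{1/\alpha}A_{XY}\Big\}.$$ (Here $\omega^{1/2}$ stands for $\omega^{1/2}\otimes I_Y$, and the infimum of the empty set is $+\infty$.)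
   Context: $\mathscr D(X)$ is the set of density operators on $X$; $\|\cdot\|_\infty$ is the operator norm. For $\beta\in(0,1)$ and positive semidefinite $A,B$, $A\#_\beta B:=\lim_{\varepsilon\downarrow0}A_\varepsilon^{1/2}(A_\varepsilon^{-1/2}B_\varepsilon A_\varepsilon^{-1/2})^{\beta}A_\varepsilon^{1/2}$, $A_\varepsilon=A+\varepsilon I$, $B_\varepsilon=B+\varepsilon I$. For states: $Q^{\#}_\alpha(\rho\|\sigma):=\inf\{\mathrm{tr}(A): A\ge 0,\ \rho\le\sigma\#_{1/\alpha}A\}$, $D^{\#}_\alpha:=\frac{1}{\alpha-1}\log_2 Q^{\#}_\alpha$. Choi operator: $J^{\mathcal N}_{XY}=(\mathcal I_X\otimes\mathcal N)(\Phi_{XX'})$ with $\Phi_{XX'}=\sum_{x,x'}|x\rangle\langle x'|_X\otimes|x\rangle\langle x'|_{X'}$ for a fixed basis. For a divergence $\mathbf D$ on operators, the channel divergence is $\mathbf D(\mathcal N\|\mathcal M):=\sup_{\omega\in\mathscr D(X)}\mathbf D\big((\omega^{1/2}\otimes I_Y)J^{\mathcal N}_{XY}(\omega^{1/2}\otimes I_Y)\,\|\,(\omega^{1/2}\otimes I_Y)J^{\mathcal M}_{XY}(\omega^{1/2}\otimes I_Y)\big)$. *)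

theory Defs
  imports "HOL-Analysis.Analysis"
begin

text \<open>Operators on a finite-dimensional Hilbert space with orthonormal basis indexed
by a finite type 'n are represented as matrices of type complex^'n^'n.
The composite system XY is indexed by the product type 'x \<times> 'y.\<close>

type_synonym 'n cmat = "complex^'n^'n"

definition adj :: "('n::finite) cmat \<Rightarrow> 'n cmat" where
  "adj A = (\<chi> i j. cnj (A$j$i))"

definition cscale :: "complex \<Rightarrow> ('n::finite) cmat \<Rightarrow> 'n cmat" where
  "cscale c A = (\<chi> i j. c * A$i$j)"

definition trace :: "('n::finite) cmat \<Rightarrow> complex" where
  "trace A = (\<Sum>i\<in>UNIV. A$i$i)"

definition qform :: "('n::finite) cmat \<Rightarrow> complex^'n \<Rightarrow> complex" where
  "qform A v = (\<Sum>i\<in>UNIV. cnj (v$i) * (A *v v)$i)"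

text \<open>positive semidefinite (for complex matrices this entails Hermitian)\<close>
definition psd :: "('n::finite) cmat \<Rightarrow> bool" where
  "psd A \<longleftrightarrow> (\<forall>v. qform A v \<in> \<real> \<and> 0 \<le> Re (qform A v))"

definition loewner_le :: "('n::finite) cmat \<Rightarrow> 'n cmat \<Rightarrow> bool" where
  "loewner_le A B \<longleftrightarrow> psd (B - A)"

definition density :: "('n::finite) cmat set" where
  "density = {\<omega>. psd \<omega> \<and> trace \<omega> = 1}"

definition unitary :: "('n::finite) cmat \<Rightarrow> bool" where
  "unitary U \<longleftrightarrow> U ** adj U = mat 1 \<and> adj U ** U = mat 1"

definition diagm :: "(('n::finite) \<Rightarrow> real) \<Rightarrow> 'n cmat" where
  "diagm d = (\<chi> i j. if i = j then complex_of_real (d i) else 0)"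

text \<open>Real power of a PSD (or positive definite) matrix via its spectral decomposition
A = U diag(l) U^*: A^t = U diag(l^t) U^*. (For eigenvalue 0 and t>0 this gives 0;
negative powers are only used on positive definite matrices.)\<close>
definition mpow :: "('n::finite) cmat \<Rightarrow> real \<Rightarrow> 'n cmat" where
  "mpow A t = (let p = (SOME p. unitary (fst p) \<and> A = fst p ** diagm (snd p) ** adj (fst p))
               in fst p ** diagm (\<lambda>i. snd p i powr t) ** adj (fst p))"

definition gmean :: "real \<Rightarrow> ('n::finite) cmat \<Rightarrow> 'n cmat \<Rightarrow> 'n cmat" where
  "gmean \<beta> A B = Lim (at_right 0) (\<lambda>\<epsilon>::real.
     let Ae = A + mat (complex_of_real \<epsilon>); Be = B + mat (complex_of_real \<epsilon>)
     in mpow Ae (1/2) ** mpow (mpow Ae (-1/2) ** Be ** mpow Ae (-1/2)) \<beta> ** mpow Ae (1/2))"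

definition Qsharp :: "real \<Rightarrow> ('n::finite) cmat \<Rightarrow> 'n cmat \<Rightarrow> ereal" where
  "Qsharp \<alpha> \<rho> \<sigma> = Inf {ereal (Re (trace A)) | A. psd A \<and> loewner_le \<rho> (gmean (1/\<alpha>) \<sigma> A)}"

definition elog2 :: "ereal \<Rightarrow> ereal" where
  "elog2 x = (if x = \<infinity> then \<infinity> else if x \<le> 0 then -\<infinity> else ereal (log 2 (real_of_ereal x)))"

definition Dsharp :: "real \<Rightarrow> ('n::finite) cmat \<Rightarrow> 'n cmat \<Rightarrow> ereal" where
  "Dsharp \<alpha> \<rho> \<sigma> = ereal (1 / (\<alpha> - 1)) * elog2 (Qsharp \<alpha> \<rho> \<sigma>)"

definition kron :: "('x::finite) cmat \<Rightarrow> ('y::finite) cmat \<Rightarrow> ('x \<times> 'y) cmat" where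
  "kron A B = (\<chi> p q. A$(fst p)$(fst q) * B$(snd p)$(snd q))"

definition ptrY :: "(('x::finite) \<times> ('y::finite)) cmat \<Rightarrow> 'x cmat" where
  "ptrY A = (\<chi> i k. \<Sum>j\<in>UNIV. A$(i,j)$(k,j))"

definition opnorm :: "('n::finite) cmat \<Rightarrow> real" where
  "opnorm A = onorm (\<lambda>v. A *v v)"

definition eunit :: "('n::finite) \<Rightarrow> 'n \<Rightarrow> 'n cmat" where
  "eunit a b = (\<chi> i j. if i = a \<and> j = b then 1 else 0)"

definition choi :: "(('x::finite) cmat \<Rightarrow> ('y::finite) cmat) \<Rightarrow> ('x \<times> 'y) cmat" where
  "choi N = (\<Sum>a\<in>UNIV. \<Sum>b\<in>UNIV. kron (eunit a b) (N (eunit a b)))"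

text \<open>Complete positivity: linear, and id_k \<otimes> N is positive for every ancilla
dimension k. Operators on C^k \<otimes> X' are represented as functions on index pairs,
with the ancilla index ranging over {..<k}.\<close>
definition psd_on :: "'a set \<Rightarrow> ('a \<Rightarrow> 'a \<Rightarrow> complex) \<Rightarrow> bool" where
  "psd_on I A \<longleftrightarrow> (\<forall>v. (\<Sum>p\<in>I. \<Sum>q\<in>I. cnj (v p) * A p q * v q) \<in> \<real>
                      \<and> 0 \<le> Re (\<Sum>p\<in>I. \<Sum>q\<in>I. cnj (v p) * A p q * v q))"

definition id_tensor :: "(('x::finite) cmat \<Rightarrow> ('y::finite) cmat)
   \<Rightarrow> (nat \<times> 'x \<Rightarrow> nat \<times> 'x \<Rightarrow> complex) \<Rightarrow> (nat \<times> 'y \<Rightarrow> nat \<times> 'y \<Rightarrow> complex)" where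
  "id_tensor N A = (\<lambda>(a, y) (b, y'). (N (\<chi> x x'. A (a, x) (b, x')))$y$y')"

definition completely_positive :: "(('x::finite) cmat \<Rightarrow> ('y::finite) cmat) \<Rightarrow> bool" where
  "completely_positive N \<longleftrightarrow>
     (\<forall>c A B. N (cscale c A + B) = cscale c (N A) + N B) \<and>
     (\<forall>k A. psd_on ({..<k} \<times> UNIV) A \<longrightarrow> psd_on ({..<k} \<times> UNIV) (id_tensor N A))"

definition sandw :: "('x::finite) cmat \<Rightarrow> ('x \<times> ('y::finite)) cmat \<Rightarrow> ('x \<times> 'y) cmat" where
  "sandw \<omega> J = kron (mpow \<omega> (1/2)) (mat 1) ** J ** kron (mpow \<omega> (1/2)) (mat 1)"

definition chan_div :: "((('x::finite) \<times> ('y::finite)) cmat \<Rightarrow> ('x \<times> 'y) cmat \<Rightarrow> ereal)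
   \<Rightarrow> ('x cmat \<Rightarrow> 'y cmat) \<Rightarrow> ('x cmat \<Rightarrow> 'y cmat) \<Rightarrow> ereal" where
  "chan_div D N M = (SUP \<omega>\<in>density. D (sandw \<omega> (choi N)) (sandw \<omega> (choi M)))"

definition Dsharp_ch :: "real \<Rightarrow> (('x::finite) cmat \<Rightarrow> ('y::finite) cmat) \<Rightarrow> ('x cmat \<Rightarrow> 'y cmat) \<Rightarrow> ereal" where
  "Dsharp_ch \<alpha> N M = chan_div (Dsharp \<alpha>) N M"

definition Qsharp_ch :: "real \<Rightarrow> (('x::finite) cmat \<Rightarrow> ('y::finite) cmat) \<Rightarrow> ('x cmat \<Rightarrow> 'y cmat) \<Rightarrow> ereal" where
  "Qsharp_ch \<alpha> N M = (SUP \<omega>\<in>density. Qsharp \<alpha> (sandw \<omega> (choi N)) (sandw \<omega> (choi M)))"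

end

theory Submission
  imports Defs
begin

text \<open>
  For positive definite \<open>A\<close> and \<open>B\<close> write \<open>A = S S*\<close> and \<open>B = S D S*\<close> with \<open>S\<close> invertible and \<open>D\<close>
  diagonal; then \<open>A #\<^sub>\<beta> B = S D\<^sup>\<beta> S*\<close>. Since \<open>t\<^sup>\<beta>\<close> is a positive multiple of the integral over \<open>u\<close> of
  \<open>exp (\<beta>u) t / (t + exp u)\<close>, the quadratic form of \<open>A #\<^sub>\<beta> B\<close> at \<open>x\<close> is an integral of terms
  \<open>exp (\<beta>u) min\<^sub>y (\<langle>y, A y\<rangle> + exp (-u) \<langle>x - y, B (x - y)\<rangle>)\<close>. Being minima of functions linear in
  \<open>(A, B)\<close>, these terms yield monotonicity, joint concavity and the transformer inequality
  \<open>K (A # B) K* \<le> (K A K*) # (K B K*)\<close>, with equality for invertible \<open>K\<close>; all of them pass to the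
  limit that defines the mean of semidefinite matrices.

  If \<open>A\<close> is feasible for the Choi operators, the transformer inequality makes \<open>\<omega>\<^sup>1\<^sup>/\<^sup>2 A \<omega>\<^sup>1\<^sup>/\<^sup>2\<close> feasible for
  the compressed pair, and its trace \<open>tr (\<omega> tr\<^sub>Y A)\<close> is at most the norm of \<open>tr\<^sub>Y A\<close>. For invertible
  \<open>\<omega>\<close> every feasible operator of the compressed pair has this form, so the converse inequality is the
  minimax identity for \<open>tr (\<omega> tr\<^sub>Y A)\<close>. The feasible set is convex, hence if no \<open>tr\<^sub>Y A\<close> lies below
  \<open>r I\<close>, a separating hyperplane gives a density \<open>\<omega>\<close> with \<open>tr (\<omega> tr\<^sub>Y A) \<ge> r\<close> for all feasible \<open>A\<close>;
  mixing in a little of the identity makes \<open>\<omega>\<close> invertible.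
\<close>

subsection \<open>Hermitian forms and the spectral theorem\<close>

definition hin :: "complex^('n::finite) \<Rightarrow> complex^'n \<Rightarrow> complex" where
  "hin u v = (\<Sum>i\<in>UNIV. cnj (u$i) * v$i)"

lemma hin_add_left: "hin (u + v) w = hin u w + hin v w"
  by (simp add: hin_def algebra_simps sum.distrib)

lemma hin_add_right: "hin u (v + w) = hin u v + hin u w"
  by (simp add: hin_def algebra_simps sum.distrib)

lemma hin_diff_right: "hin u (v - w) = hin u v - hin u w"
  by (simp add: hin_def algebra_simps sum_subtractf)

lemma hin_smult_left: "hin (c *s u) v = cnj c * hin u v"
  by (simp add: hin_def algebra_simps sum_distrib_left)

lemma hin_smult_right: "hin u (c *s v) = c * hin u v"
  by (simp add: hin_def algebra_simps sum_distrib_left)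

lemma cnj_hin: "cnj (hin u v) = hin v u"
  by (simp add: hin_def mult.commute)

lemma hin_self: "hin u u = complex_of_real ((norm u)\<^sup>2)"
proof -
  have "cnj z * z = complex_of_real ((cmod z)\<^sup>2)" for z
    by (metis complex_norm_square mult.commute)
  thus ?thesis
    by (simp add: hin_def norm_vec_def L2_set_def sum_nonneg)
qed

lemma inner_eq_Re_hin: "u \<bullet> v = Re (hin u v)"
  by (simp add: hin_def inner_vec_def inner_complex_def)

lemma adj_nth [simp]: "adj A $ i $ j = cnj (A $ j $ i)"
  by (simp add: adj_def)

lemma adj_adj [simp]: "adj (adj A) = A"
  by (simp add: vec_eq_iff)

lemma adj_mult: "adj (A ** B) = adj B ** adj A"
  by (simp add: vec_eq_iff matrix_matrix_mult_def mult.commute)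

lemma adj_add: "adj (A + B) = adj A + adj B"
  by (simp add: vec_eq_iff)

lemma adj_diff: "adj (A - B) = adj A - adj B"
  by (simp add: vec_eq_iff)

lemma adj_mat: "adj (mat c) = mat (cnj c)"
  by (auto simp: vec_eq_iff mat_def)

lemma adj_diagm: "adj (diagm d) = diagm d"
  by (auto simp: vec_eq_iff diagm_def)

lemma hin_adj: "hin u (A *v v) = hin (adj A *v u) v"
  by (simp add: hin_def matrix_vector_mult_def sum_distrib_left sum_distrib_right algebra_simps)
     (subst sum.swap, simp)

lemma qform_hin: "qform A v = hin v (A *v v)"
  by (simp add: qform_def hin_def)

lemma qform_congruence: "qform (K ** A ** adj K) x = qform A (adj K *v x)"
  by (simp add: qform_hin hin_adj matrix_vector_mul_assoc[symmetric])

lemma diagm_mult: "diagm d ** diagm e = diagm (\<lambda>i. d i * e i)"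
  by (auto simp: vec_eq_iff matrix_matrix_mult_def diagm_def if_distrib[of "\<lambda>z. z * _"] sum.delta cong: if_cong)

lemma diagm_one: "diagm (\<lambda>i. 1) = mat 1"
  by (auto simp: vec_eq_iff diagm_def mat_def)

lemma diagm_mult_vec: "(diagm d *v v) $ i = complex_of_real (d i) * v $ i"
  by (simp add: matrix_vector_mult_def diagm_def if_distrib[of "\<lambda>z. z * _"] sum.delta cong: if_cong)

lemma qform_diagm: "qform (diagm d) v = complex_of_real (\<Sum>i\<in>UNIV. d i * (cmod (v$i))\<^sup>2)"
proof -
  have "cnj z * (complex_of_real r * z) = complex_of_real (r * (cmod z)\<^sup>2)" for z r
    by (metis complex_norm_square mult.commute mult.left_commute of_real_mult)
  thus ?thesis by (simp only: qform_def diagm_mult_vec of_real_sum)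
qed

lemma qform_add: "qform (A + B) v = qform A v + qform B v"
  by (simp add: qform_hin matrix_vector_mult_add_rdistrib hin_add_right)

lemma qform_diff: "qform (A - B) v = qform A v - qform B v"
  by (simp add: qform_hin matrix_vector_mult_diff_rdistrib hin_diff_right)

lemma qform_mat: "qform (mat c) v = c * complex_of_real ((norm v)\<^sup>2)"
proof -
  have "mat c *v v = c *s v"
    by (simp add: vec_eq_iff matrix_vector_mult_def mat_def if_distrib[of "\<lambda>z. z * _"] sum.delta cong: if_cong)
  thus ?thesis by (simp add: qform_hin hin_smult_right hin_self)
qed

lemma qform_smult: "qform A (c *s v) = (complex_of_real ((cmod c)\<^sup>2)) * qform A v"
proof -
  have "A *v (c *s v) = c *s (A *v v)" by (simp add: vector_scalar_commute)
  moreover have "c * cnj c = complex_of_real ((cmod c)\<^sup>2)" by (metis complex_norm_square)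
  ultimately show ?thesis by (simp add: qform_hin hin_smult_right hin_smult_left mult.assoc[symmetric])
qed

lemma qform_vadd: "qform A (u + v) = qform A u + hin u (A *v v) + hin v (A *v u) + qform A v"
  by (simp add: qform_hin matrix_vector_right_distrib hin_add_left hin_add_right)

lemma hin_axis: "hin (axis i 1) v = v $ i"
  by (simp add: hin_def axis_def if_distrib[of cnj] if_distrib[of "\<lambda>z. z * _"] sum.delta cong: if_cong)

lemma mult_axis: "(A *v axis j 1) $ i = (A :: complex^'n^'n) $ i $ j"
  by (simp add: matrix_vector_mult_def axis_def if_distrib[of "\<lambda>z. _ * z"] sum.delta cong: if_cong)

text \<open>Over the complex numbers the quadratic form determines every entry, with
  \<open>A\<close> arbitrary. This serves twice: real values of the form force \<open>A\<close> to
  be Hermitian, and convergence of forms yields convergence of matrices.\<close>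

lemma polarisation:
  fixes A :: "('n::finite) cmat"
  shows "4 * A $ i $ j = qform A (axis i 1 + axis j 1) - qform A (axis i 1 + (-1) *s axis j 1)
    - \<i> * qform A (axis i 1 + \<i> *s axis j 1) + \<i> * qform A (axis i 1 + (-\<i>) *s axis j 1)"
proof -
  have m: "A *v (c *s v) = c *s (A *v v)" for c v by (simp add: vector_scalar_commute)
  show ?thesis
    by (simp only: qform_vadd qform_smult m hin_smult_left hin_smult_right hin_axis mult_axis)
       (simp add: algebra_simps)
qed

text \<open>Conjugating the polarisation identity only changes the signs in front of \<i>.
  Exchanging \<open>i\<close> and \<open>j\<close> has the same effect, because pulling a factor of
  modulus 1 out of the vector leaves the form unchanged.\<close>

lemma psd_hermitian:
  fixes A :: "('n::finite) cmat"
  assumes "psd A" shows "adj A = A"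
proof -
  have r: "cnj (qform A v) = qform A v" for v
    using assms by (simp add: psd_def Reals_cnj_iff)
  have s: "qform A (axis j 1 + axis i 1) = qform A (axis i 1 + axis j 1)" for i j
    by (subst add.commute) (rule refl)
  have q: "qform A (axis i 1 + c *s axis j 1) = qform A (axis j 1 + cnj c *s axis i 1)"
    if "cmod c = 1" for i j and c :: complex
  proof -
    have cc: "c * cnj c = 1" using that by (metis complex_norm_square of_real_1 power_one)
    hence "axis i 1 + c *s axis j 1 = c *s (axis j 1 + cnj c *s axis i 1)"
      by (simp add: vec_eq_iff algebra_simps axis_def)
    thus ?thesis using that by (simp only: qform_smult) simp
  qed
  have "4 * cnj (A $ j $ i) = 4 * A $ i $ j" for i j
  proof -
    have "cnj (4 * A $ j $ i) = qform A (axis j 1 + axis i 1) - qform A (axis j 1 + (-1) *s axis i 1)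
    + \<i> * qform A (axis j 1 + \<i> *s axis i 1) - \<i> * qform A (axis j 1 + (-\<i>) *s axis i 1)"
      unfolding polarisation by (simp only: complex_cnj_diff complex_cnj_add complex_cnj_mult r) simp
    also have "\<dots> = 4 * A $ i $ j"
      unfolding polarisation
      using q[of "-1" j i] q[of "\<i>" j i] q[of "-\<i>" j i] s[of j i] by simp
    finally show ?thesis by simp
  qed
  thus ?thesis by (simp add: vec_eq_iff)
qed

lemma hermitian_qform_real:
  assumes "adj A = A" shows "qform A v = complex_of_real (Re (qform A v))"
proof -
  have "cnj (qform A v) = qform A v"
    by (simp add: qform_hin cnj_hin) (metis hin_adj assms)
  thus ?thesis by (metis Reals_cnj_iff of_real_Re)
qed

lemma psd_iff: "psd A \<longleftrightarrow> adj A = A \<and> (\<forall>v. 0 \<le> Re (qform A v))"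
  by (metis psd_hermitian hermitian_qform_real psd_def Reals_of_real)

section \<open>The spectral theorem, by maximising the quadratic form\<close>

lemma exists_orthogonal:
  fixes f :: "'n::finite \<Rightarrow> complex^'n"
  assumes "S \<noteq> UNIV"
  shows "\<exists>v. v \<noteq> 0 \<and> (\<forall>i\<in>S. hin (f i) v = 0)"
proof -
  obtain k where k: "k \<notin> S" using assms by auto
  \<comment> \<open>The rows in \<open>S\<close> encode orthogonality to the \<open>f i\<close>; row
    \<open>k\<close> is zero, so \<open>M\<close> is singular and has a nonzero kernel
    vector.\<close>
  define M :: "'n cmat" where "M = (\<chi> i j. if i \<in> S then cnj (f i $ j) else 0)"
  have "\<not> (\<forall>x. M *v x = 0 \<longrightarrow> x = 0)"
  proof
    assume "\<forall>x. M *v x = 0 \<longrightarrow> x = 0"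
    then obtain B where "B ** M = mat 1" using matrix_left_invertible_ker[of M] by blast
    hence "M ** B = mat 1" using matrix_left_right_inverse by blast
    hence "(M ** B) $ k $ k = 1" by (simp add: mat_def)
    moreover have "(M ** B) $ k $ k = 0" using k by (simp add: matrix_matrix_mult_def M_def)
    ultimately show False by simp
  qed
  then obtain x where x: "M *v x = 0" "x \<noteq> 0" by blast
  have "hin (f i) x = 0" if "i \<in> S" for i
  proof -
    have "(M *v x) $ i = hin (f i) x" using that by (simp add: matrix_vector_mult_def M_def hin_def)
    thus ?thesis using x by simp
  qed
  thus ?thesis using x by blast
qed

lemma linear_le_quadratic_imp_nonpos:
  fixes a b :: real
  assumes "\<And>t. t > 0 \<Longrightarrow> t * a \<le> t\<^sup>2 * b"
  shows "a \<le> 0"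
proof (rule ccontr)
  assume "\<not> a \<le> 0"
  \<comment> \<open>Small enough that \<open>t * b\<close> is at most \<open>a / 2\<close>.\<close>
  define t where "t = a / (2 * (\<bar>b\<bar> + 1))"
  have t: "t > 0" using \<open>\<not> a \<le> 0\<close> by (simp add: t_def field_simps)
  have "a \<le> t * b" using assms[OF t] t by (simp add: power2_eq_square)
  also have "\<dots> \<le> t * (\<bar>b\<bar> + 1)" using t by (intro mult_left_mono) auto
  also have "\<dots> = a / 2" using abs_ge_zero[of b] by (simp add: t_def divide_simps)
  finally show False using \<open>\<not> a \<le> 0\<close> by simp
qed

lemma Re_qform_continuous: "continuous_on UNIV (\<lambda>v. Re (qform A v))"
  unfolding qform_def matrix_vector_mult_def by (intro continuous_intros)

text \<open>The orthogonal complement \<open>W\<close> of the given eigenvectors is invariant under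
  \<open>A\<close>. A maximiser \<open>u\<close> of the form on the unit sphere of \<open>W\<close>
  is an eigenvector: the residual \<open>r\<close> of the eigenvalue equation lies in
  \<open>W\<close>, and stationarity in direction \<open>r\<close> forces
  \<open>r = 0\<close>.\<close>

lemma eigenvector_in_complement:
  fixes A :: "('n::finite) cmat" and f :: "'n \<Rightarrow> complex^'n"
  assumes h: "adj A = A" and S: "S \<noteq> UNIV"
    and inv: "\<And>i. i \<in> S \<Longrightarrow> A *v f i = complex_of_real (d i) *s f i"
  shows "\<exists>u \<mu>. hin u u = 1 \<and> (\<forall>i\<in>S. hin (f i) u = 0) \<and> A *v u = complex_of_real \<mu> *s u"
proof -
  define W where "W = {v. \<forall>i\<in>S. hin (f i) v = 0}"
  have W_smult: "c *s v \<in> W" if "v \<in> W" for c v using that by (simp add: W_def hin_smult_right)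
  have W_add: "u + v \<in> W" if "u \<in> W" "v \<in> W" for u v using that by (simp add: W_def hin_add_right)
  have W_diff: "u - v \<in> W" if "u \<in> W" "v \<in> W" for u v using that by (simp add: W_def hin_diff_right)
  have W_A: "A *v v \<in> W" if "v \<in> W" for v
    using that inv by (simp add: W_def hin_adj h hin_smult_left)
  have clW: "closed W"
  proof -
    have "W = (\<Inter>i\<in>S. {v. hin (f i) v = 0})" by (auto simp: W_def)
    moreover have "closed {v. hin (f i) v = 0}" for i
      unfolding hin_def by (intro closed_Collect_eq continuous_intros)
    ultimately show ?thesis by auto
  qed
  obtain v where v: "v \<noteq> 0" "v \<in> W" using exists_orthogonal[OF S, of f] by (auto simp: W_def)
  have nsm: "norm (complex_of_real c *s x) = \<bar>c\<bar> * norm x" for c and x :: "complex^'n"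
  proof -
    have "complex_of_real c *s x = c *\<^sub>R x"
      by (simp add: vec_eq_iff) (simp add: scaleR_conv_of_real)
    thus ?thesis by simp
  qed
  have "complex_of_real (1 / norm v) *s v \<in> W \<inter> sphere 0 1"
    using v W_smult nsm[of "1 / norm v" v] by simp
  hence ne: "W \<inter> sphere 0 1 \<noteq> {}" by blast
  have "compact (W \<inter> sphere 0 1)" using clW by (simp add: closed_Int_compact)
  then obtain u where u: "u \<in> W \<inter> sphere 0 1"
    and mx: "\<And>w. w \<in> W \<inter> sphere 0 1 \<Longrightarrow> Re (qform A w) \<le> Re (qform A u)"
    using continuous_attains_sup[OF _ ne continuous_on_subset[OF Re_qform_continuous subset_UNIV, of _ A]]
    by metis
  define \<mu> where "\<mu> = Re (qform A u)"
  have le: "Re (qform A w) \<le> \<mu> * (norm w)\<^sup>2" if "w \<in> W" for w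
  proof (cases "w = 0")
    case True thus ?thesis by (simp add: qform_def)
  next
    case False
    have "complex_of_real (1 / norm w) *s w \<in> W \<inter> sphere 0 1"
      using that False W_smult nsm[of "1 / norm w" w] by simp
    from mx[OF this] have "(1 / norm w)\<^sup>2 * Re (qform A w) \<le> \<mu>"
      using False by (simp add: qform_smult \<mu>_def norm_divide power_divide Re_divide_of_real)
    thus ?thesis using False by (simp add: field_simps)
  qed
  define r where "r = A *v u - complex_of_real \<mu> *s u"
  have rW: "r \<in> W" unfolding r_def using u by (intro W_diff W_A W_smult) auto
  \<comment> \<open>Comparing \<open>u\<close> with \<open>u + t r\<close>, the gain of first order
    is \<open>2 t\<close> times the squared norm of \<open>r\<close>, and the remaining terms are of
    order \<open>t^2\<close>.\<close>
  have "2 * Re (hin r r) \<le> 0"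
  proof (rule linear_le_quadratic_imp_nonpos)
    fix t :: real assume "t > 0"
    define w where "w = complex_of_real t *s r"
    have nu: "hin u u = 1" using u by (simp add: hin_self)
    have qu: "qform A u = complex_of_real \<mu>" unfolding \<mu>_def using hermitian_qform_real[OF h] .
    have c1: "Re (hin u (A *v r)) = Re (hin r (A *v u))"
      using cnj_hin[of r "A *v u"] hin_adj[of u A r] h by (metis cnj.simps(1))
    have "Re (qform A (u + w)) \<le> \<mu> * (norm (u + w))\<^sup>2"
      using u rW by (intro le W_add) (auto simp: w_def W_smult)
    moreover have "(norm (u + w))\<^sup>2 = Re (hin (u + w) (u + w))" by (simp add: hin_self)
    moreover have "\<dots> = 1 + 2 * t * Re (hin r u) + t\<^sup>2 * Re (hin r r)"
      using nu cnj_hin[of r u, symmetric]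
      by (simp add: w_def hin_add_left hin_add_right hin_smult_left hin_smult_right power2_eq_square algebra_simps)
    moreover have "Re (qform A (u + w)) = \<mu> + 2 * t * Re (hin r (A *v u)) + t\<^sup>2 * Re (qform A r)"
      using c1 by (simp add: qform_vadd qu w_def hin_smult_left hin_smult_right vector_scalar_commute qform_smult
          norm_power)
    ultimately have "2 * t * (Re (hin r (A *v u)) - \<mu> * Re (hin r u)) \<le> t\<^sup>2 * (\<mu> * Re (hin r r) - Re (qform A r))"
      by (simp add: algebra_simps)
    moreover have "Re (hin r (A *v u)) - \<mu> * Re (hin r u) = Re (hin r r)"
      by (subst (3) r_def) (simp add: hin_diff_right hin_smult_right)
    ultimately show "t * (2 * Re (hin r r)) \<le> t\<^sup>2 * (\<mu> * Re (hin r r) - Re (qform A r))"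
      by (simp add: algebra_simps)
  qed
  hence "r = 0" by (simp add: hin_self)
  hence "A *v u = complex_of_real \<mu> *s u" by (simp add: r_def)
  thus ?thesis using u by (intro exI[of _ u] exI[of _ \<mu>]) (auto simp: hin_self W_def)
qed

text \<open>Indexing the partial eigenbasis by a subset \<open>S\<close> of the index type allows an
  induction on \<open>S\<close>; each step takes a new eigenvector in the orthogonal
  complement.\<close>

lemma orthonormal_eigenvectors:
  fixes A :: "('n::finite) cmat"
  assumes h: "adj A = A"
  shows "\<exists>(f :: 'n \<Rightarrow> complex^'n) d. (\<forall>i\<in>S. \<forall>j\<in>S. hin (f i) (f j) = (if i = j then 1 else 0))
     \<and> (\<forall>i\<in>S. A *v f i = complex_of_real (d i) *s f i)"
  using finite[of S]
proof (induction S rule: finite_induct)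
  case empty thus ?case by simp
next
  case (insert k S)
  then obtain f d where f: "\<And>i j. i \<in> S \<Longrightarrow> j \<in> S \<Longrightarrow> hin (f i) (f j) = (if i = j then 1 else 0)"
    "\<And>i. i \<in> S \<Longrightarrow> A *v f i = complex_of_real (d i) *s f i" by blast
  have "S \<noteq> UNIV" using insert by auto
  from eigenvector_in_complement[OF h this, of f d] f(2) obtain u \<mu> where
    u: "hin u u = 1" "\<forall>i\<in>S. hin (f i) u = 0" "A *v u = complex_of_real \<mu> *s u" by blast
  have "hin u (f i) = 0" if "i \<in> S" for i using that u(2) cnj_hin[of "f i" u] by simp
  thus ?case using u f insert
    by (intro exI[of _ "f(k := u)"] exI[of _ "d(k := \<mu>)"]) auto
qed

theorem spectral_decomposition:
  fixes A :: "('n::finite) cmat"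
  assumes h: "adj A = A"
  obtains U d where "unitary U" "A = U ** diagm d ** adj U"
proof -
  obtain f :: "'n \<Rightarrow> complex^'n" and d where f: "\<And>i j. hin (f i) (f j) = (if i = j then 1 else 0)"
    "\<And>i. A *v f i = complex_of_real (d i) *s f i"
    using orthonormal_eigenvectors[OF h, of UNIV] by auto
  define U :: "'n cmat" where "U = (\<chi> i j. f j $ i)"
  have "adj U ** U = mat 1"
    using f(1) by (simp add: vec_eq_iff matrix_matrix_mult_def U_def mat_def hin_def)
  hence un: "unitary U" using matrix_left_right_inverse by (auto simp: unitary_def)
  have "A ** U = U ** diagm d"
  proof -
    have "(A ** U) $ i $ j = (U ** diagm d) $ i $ j" for i j
    proof -
      have "(A ** U) $ i $ j = (A *v f j) $ i"
        by (simp add: matrix_matrix_mult_def matrix_vector_mult_def U_def)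
      also have "\<dots> = (U ** diagm d) $ i $ j"
        by (simp add: f(2) matrix_matrix_mult_def diagm_def U_def if_distrib[of "\<lambda>z. _ * z"] sum.delta
            mult.commute cong: if_cong)
      finally show ?thesis .
    qed
    thus ?thesis by (simp add: vec_eq_iff)
  qed
  hence "A ** U ** adj U = U ** diagm d ** adj U" by simp
  hence "A = U ** diagm d ** adj U" using un by (simp add: matrix_mul_assoc[symmetric] unitary_def)
  thus ?thesis using un that by blast
qed

subsection \<open>Matrix powers and simultaneous congruence\<close>

text \<open>The matrix \<open>W\<close> intertwines \<open>diagm d\<close> and
  \<open>diagm e\<close>, so its entry at \<open>i\<close>, \<open>j\<close> vanishes unless
  \<open>d j = e i\<close>. Hence \<open>W\<close> also intertwines the diagonal matrices after
  applying \<open>g\<close>.\<close>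

lemma diagonalisation_function_unique:
  assumes U: "unitary U" and V: "unitary V"
    and eq: "U ** diagm d ** adj U = V ** diagm e ** adj V"
  shows "U ** diagm (\<lambda>i. g (d i)) ** adj U = V ** diagm (\<lambda>i. g (e i)) ** adj V"
proof -
  define W where "W = adj V ** U"
  have Wnth: "(W ** diagm d') $ i $ j = W $ i $ j * complex_of_real (d' j)"
    "(diagm d' ** W) $ i $ j = complex_of_real (d' i) * W $ i $ j" for d' i j
    by (simp_all add: matrix_matrix_mult_def diagm_def if_distrib[of "\<lambda>z. _ * z"]
        if_distrib[of "\<lambda>z. z * _"] sum.delta cong: if_cong)
  have VW: "V ** W = U" using V by (simp add: W_def matrix_mul_assoc unitary_def)
  have WU: "W ** adj U = adj V" using U by (simp add: W_def matrix_mul_assoc[symmetric] unitary_def)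
  have "W ** diagm d = adj V ** (U ** diagm d ** adj U) ** U"
    using U by (simp add: W_def matrix_mul_assoc[symmetric] unitary_def)
  also have "\<dots> = diagm e ** W"
    unfolding eq using V by (simp add: W_def matrix_mul_assoc unitary_def)
  finally have we: "W ** diagm d = diagm e ** W" .
  have "(W ** diagm (\<lambda>i. g (d i))) $ i $ j = (diagm (\<lambda>i. g (e i)) ** W) $ i $ j" for i j
  proof (cases "W $ i $ j = 0")
    case False
    have "(W ** diagm d) $ i $ j = (diagm e ** W) $ i $ j" using we by simp
    hence "d j = e i" using False unfolding Wnth by simp
    thus ?thesis by (simp add: Wnth)
  qed (simp add: Wnth)
  hence wg: "W ** diagm (\<lambda>i. g (d i)) = diagm (\<lambda>i. g (e i)) ** W" by (simp add: vec_eq_iff)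
  have "U ** diagm (\<lambda>i. g (d i)) ** adj U = V ** (W ** diagm (\<lambda>i. g (d i))) ** adj U"
    by (simp add: VW[symmetric] matrix_mul_assoc)
  also have "\<dots> = V ** diagm (\<lambda>i. g (e i)) ** adj V"
    unfolding wg by (simp add: matrix_mul_assoc[symmetric] WU)
  finally show ?thesis .
qed

text \<open>The decomposition picked by \<open>SOME\<close> may be replaced by any diagonalisation
  at hand.\<close>

lemma mpow_eq:
  assumes U: "unitary U" and A: "A = U ** diagm d ** adj U"
  shows "mpow A t = U ** diagm (\<lambda>i. d i powr t) ** adj U"
proof -
  define p where "p = (SOME p. unitary (fst p) \<and> A = fst p ** diagm (snd p) ** adj (fst p))"
  have "unitary (fst p) \<and> A = fst p ** diagm (snd p) ** adj (fst p)"
    unfolding p_def by (rule someI[of _ "(U, d)"]) (use assms in auto)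
  hence "U ** diagm (\<lambda>i. d i powr t) ** adj U = fst p ** diagm (\<lambda>i. snd p i powr t) ** adj (fst p)"
    using diagonalisation_function_unique[OF U, of "fst p" d "snd p" "\<lambda>r. r powr t"] A by simp
  thus ?thesis by (simp add: mpow_def p_def[symmetric])
qed

definition posdef :: "('n::finite) cmat \<Rightarrow> bool" where
  "posdef A \<longleftrightarrow> adj A = A \<and> (\<forall>v. v \<noteq> 0 \<longrightarrow> 0 < Re (qform A v))"

lemma posdef_add_mat:
  assumes "psd A" "\<epsilon> > 0" shows "posdef (A + mat (complex_of_real \<epsilon>))"
  using assms by (auto simp: posdef_def psd_iff adj_add adj_mat qform_add qform_mat intro!: add_nonneg_pos)

lemma posdef_psd: "posdef A \<Longrightarrow> psd A"
  unfolding posdef_def psd_iff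
proof safe
  fix v assume "\<forall>v. v \<noteq> 0 \<longrightarrow> 0 < Re (qform A v)"
  thus "0 \<le> Re (qform A v)" by (cases "v = 0") (auto simp: qform_def less_imp_le)
qed

lemma qform_axis: "qform A (axis i 1) = A $ i $ i"
  by (simp add: qform_hin hin_axis mult_axis)

lemma congruent_diagm_pos:
  assumes B: "posdef B" "B = S ** diagm d ** adj S" and T: "T ** S = mat 1"
  shows "d i > 0"
proof -
  \<comment> \<open>\<open>adj T\<close> inverts \<open>adj S\<close>, so this \<open>v\<close>
    isolates the diagonal entry \<open>d i\<close> in the form of \<open>B\<close>.\<close>
  define v where "v = adj T *v axis i 1"
  have "adj S ** adj T = mat 1" using T by (metis adj_mult adj_mat complex_cnj_one)
  hence v: "adj S *v v = axis i 1" by (simp add: v_def matrix_vector_mul_assoc)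
  hence "v \<noteq> 0" by (metis axis_eq_0_iff matrix_vector_mult_0_right zero_neq_one)
  hence "0 < Re (qform B v)" using B(1) by (simp add: posdef_def)
  thus ?thesis by (simp add: B(2) qform_congruence v qform_axis diagm_def)
qed

lemma psd_diagonal_nonneg:
  assumes B: "psd B" "B = U ** diagm d ** adj U" and U: "unitary U"
  shows "d i \<ge> 0"
proof -
  have v: "adj U *v (U *v axis i 1) = axis i 1" using U by (simp add: unitary_def matrix_vector_mul_assoc)
  have "0 \<le> Re (qform B (U *v axis i 1))" using B(1) by (simp add: psd_iff)
  thus ?thesis by (simp add: B(2) qform_congruence v qform_axis diagm_def)
qed

lemma posdef_mpow_half:
  assumes "posdef A"
  defines "P \<equiv> mpow A (1/2)" and "N \<equiv> mpow A (-1/2)"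
  shows "adj P = P" "adj N = N" "P ** N = mat 1" "N ** P = mat 1" "P ** P = A"
proof -
  obtain U d where U: "unitary U" and A: "A = U ** diagm d ** adj U"
    using spectral_decomposition assms(1) by (auto simp: posdef_def)
  have d: "d i > 0" for i using congruent_diagm_pos[OF assms(1) A] U by (auto simp: unitary_def)
  have P: "P = U ** diagm (\<lambda>i. d i powr (1/2)) ** adj U"
    and N: "N = U ** diagm (\<lambda>i. d i powr (-1/2)) ** adj U"
    unfolding P_def N_def by (rule mpow_eq[OF U A])+
  have mul: "(U ** diagm e ** adj U) ** (U ** diagm e' ** adj U) = U ** diagm (\<lambda>i. e i * e' i) ** adj U" for e e'
  proof -
    have "(U ** diagm e ** adj U) ** (U ** diagm e' ** adj U) = U ** diagm e ** (adj U ** U) ** diagm e' ** adj U"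
      by (simp only: matrix_mul_assoc)
    also have "\<dots> = U ** (diagm e ** diagm e') ** adj U"
      using U by (simp add: unitary_def matrix_mul_assoc)
    finally show ?thesis by (simp only: diagm_mult)
  qed
  have h: "adj (U ** diagm e ** adj U) = U ** diagm e ** adj U" for e
    by (simp add: adj_mult adj_diagm matrix_mul_assoc)
  show "adj P = P" "adj N = N" unfolding P N by (rule h)+
  have one: "U ** diagm (\<lambda>i. 1) ** adj U = mat 1" using U by (simp add: diagm_one unitary_def)
  show "P ** N = mat 1" "N ** P = mat 1" "P ** P = A"
    unfolding P N mul A using d
    by (simp_all add: powr_add[symmetric] one order.strict_implies_order less_imp_neq[THEN not_sym])
qed

lemma mpow_half_psd:
  assumes "psd A"
  shows "adj (mpow A (1/2)) = mpow A (1/2)" "mpow A (1/2) ** mpow A (1/2) = A"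
proof -
  obtain U d where U: "unitary U" and A: "A = U ** diagm d ** adj U"
    using spectral_decomposition assms(1) by (auto simp: psd_iff)
  have d: "d i \<ge> 0" for i using psd_diagonal_nonneg[OF assms(1) A U] .
  have P: "mpow A (1/2) = U ** diagm (\<lambda>i. d i powr (1/2)) ** adj U" by (rule mpow_eq[OF U A])
  show "adj (mpow A (1/2)) = mpow A (1/2)" unfolding P
    by (simp add: adj_mult adj_diagm matrix_mul_assoc)
  have "mpow A (1/2) ** mpow A (1/2)
     = U ** diagm (\<lambda>i. d i powr (1/2)) ** (adj U ** U) ** diagm (\<lambda>i. d i powr (1/2)) ** adj U"
    unfolding P by (simp only: matrix_mul_assoc)
  also have "\<dots> = U ** (diagm (\<lambda>i. d i powr (1/2)) ** diagm (\<lambda>i. d i powr (1/2))) ** adj U"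
    using U by (simp add: unitary_def matrix_mul_assoc)
  also have "\<dots> = A" unfolding A diagm_mult using d by (simp add: powr_add[symmetric])
  finally show "mpow A (1/2) ** mpow A (1/2) = A" .
qed

text \<open>Take \<open>S = P V\<close>, where \<open>P\<close> is the square root of
  \<open>A\<close> and the unitary \<open>V\<close> diagonalises \<open>N B N\<close>, with
  \<open>N\<close> the inverse of \<open>P\<close>.\<close>

lemma simultaneous_congruence:
  assumes A: "posdef A" and B: "posdef B"
  obtains S T d where "T ** S = mat 1" "S ** T = mat 1" "A = S ** adj S"
    "B = S ** diagm d ** adj S" "\<And>i. d i > 0"
proof -
  define P where "P = mpow A (1/2)"
  define N where "N = mpow A (-1/2)"
  note PN = posdef_mpow_half[OF A, folded P_def N_def]
  have "adj (N ** B ** N) = N ** B ** N"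
    using B PN(2) by (simp add: adj_mult posdef_def matrix_mul_assoc)
  then obtain V d where V: "unitary V" and d: "N ** B ** N = V ** diagm d ** adj V"
    using spectral_decomposition by blast
  define S where "S = P ** V"
  define T where "T = adj V ** N"
  have TS: "T ** S = mat 1"
  proof -
    have "T ** S = adj V ** (N ** P) ** V" by (simp add: S_def T_def matrix_mul_assoc)
    thus ?thesis using V PN by (simp add: unitary_def)
  qed
  moreover have "S ** T = mat 1" using TS matrix_left_right_inverse by blast
  moreover have "A = S ** adj S"
  proof -
    have "S ** adj S = P ** (V ** adj V) ** P" using PN(1) by (simp add: S_def adj_mult matrix_mul_assoc)
    thus ?thesis using V PN by (simp add: unitary_def)
  qed
  moreover have Beq: "B = S ** diagm d ** adj S"
  proof -
    have "S ** diagm d ** adj S = P ** (V ** diagm d ** adj V) ** P"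
      using PN(1) by (simp add: S_def adj_mult matrix_mul_assoc)
    also have "\<dots> = (P ** N) ** B ** (N ** P)" unfolding d[symmetric] by (simp only: matrix_mul_assoc)
    finally show ?thesis using PN by simp
  qed
  ultimately show ?thesis using that congruent_diagm_pos[OF B Beq TS] by blast
qed

text \<open>The formula inside the limit of \<open>gmean\<close>, applied to the regularised
  matrices.\<close>

definition gm :: "real \<Rightarrow> ('n::finite) cmat \<Rightarrow> 'n cmat \<Rightarrow> 'n cmat" where
  "gm \<beta> A B = mpow A (1/2) ** mpow (mpow A (-1/2) ** B ** mpow A (-1/2)) \<beta> ** mpow A (1/2)"

text \<open>\<open>W\<close>, the inverse square root of \<open>A\<close> times \<open>S\<close>, is
  unitary and diagonalises the matrix inside the power. The resulting formula no longer mentions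
  square roots and holds for every such factorisation.\<close>

lemma gm_congruence:
  assumes TS: "T ** S = mat 1" and A: "posdef A" "A = S ** adj S" and B: "B = S ** diagm d ** adj S"
  shows "gm \<beta> A B = S ** diagm (\<lambda>i. d i powr \<beta>) ** adj S"
proof -
  define P where "P = mpow A (1/2)"
  define N where "N = mpow A (-1/2)"
  note PN = posdef_mpow_half[OF A(1), folded P_def N_def]
  define W where "W = N ** S"
  have "W ** adj W = N ** A ** N" using PN(2) by (simp add: W_def A adj_mult matrix_mul_assoc)
  also have "\<dots> = (N ** P) ** (P ** N)" unfolding PN(5)[symmetric] by (simp only: matrix_mul_assoc)
  finally have "W ** adj W = mat 1" using PN by simp
  hence W: "unitary W" using matrix_left_right_inverse by (auto simp: unitary_def)
  have "N ** B ** N = W ** diagm d ** adj W" using PN(2) by (simp add: W_def B adj_mult matrix_mul_assoc)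
  from mpow_eq[OF W this] have "gm \<beta> A B = P ** (W ** diagm (\<lambda>i. d i powr \<beta>) ** adj W) ** P"
    by (simp add: gm_def P_def N_def)
  also have "\<dots> = (P ** N) ** S ** diagm (\<lambda>i. d i powr \<beta>) ** adj S ** (N ** P)"
    using PN(2) by (simp add: W_def adj_mult matrix_mul_assoc)
  finally show ?thesis using PN by simp
qed

lemma gm_psd:
  assumes "posdef A" "posdef B" shows "psd (gm \<beta> A B)"
proof -
  obtain S T d where *: "T ** S = mat 1" "S ** T = mat 1" "A = S ** adj S"
    "B = S ** diagm d ** adj S" "\<And>i. d i > 0" using simultaneous_congruence[OF assms] by blast
  show ?thesis unfolding gm_congruence[OF *(1) assms(1) *(3,4)] psd_def qform_congruence qform_diagm
    by (auto intro!: sum_nonneg)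
qed

subsection \<open>The geometric mean of positive definite matrices\<close>

definition pow_kernel :: "real \<Rightarrow> real \<Rightarrow> real" where
  "pow_kernel \<beta> u = exp (\<beta> * u) * (1 / (1 + exp u))"

text \<open>The kernel is dominated by \<open>exp (- (1 - \<beta>) * u)\<close> on the right
  half-line and by \<open>exp (\<beta> * u)\<close> on the left one.\<close>

lemma pow_kernel_integrable:
  assumes "0 < \<beta>" "\<beta> < 1"
  shows "integrable lborel (pow_kernel \<beta>)"
proof -
  define g where "g = (\<lambda>c u::real. indicator {0..} u * exp (- c * u))"
  have g: "integrable lborel (g c)" if "c > 0" for c
  proof -
    have "(\<lambda>u. exp (- c * u)) absolutely_integrable_on {0..}"
      using that by (intro nonnegative_absolutely_integrable_1 integrable_on_exp_minus_to_infinity) auto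
    hence "integrable lebesgue (g c)" by (simp add: set_integrable_def g_def)
    moreover have "g c \<in> borel_measurable lborel" unfolding g_def by measurable
    ultimately show ?thesis by (simp add: integrable_completion)
  qed
  have g0: "g c u \<ge> 0" for c u by (simp add: g_def)
  have k0: "pow_kernel \<beta> u \<ge> 0" for u by (simp add: pow_kernel_def add_nonneg_nonneg)
  have "integrable lborel (\<lambda>u. g (1 - \<beta>) u + g \<beta> (0 + (-1) * u))"
    using assms by (intro Bochner_Integration.integrable_add lborel_integrable_real_affine g) auto
  moreover have "pow_kernel \<beta> \<in> borel_measurable lborel" unfolding pow_kernel_def by measurable
  moreover have "norm (pow_kernel \<beta> u) \<le> norm (g (1 - \<beta>) u + g \<beta> (0 + (-1) * u))" for u
  proof (cases "u \<ge> 0")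
    case True
    have "pow_kernel \<beta> u \<le> exp (\<beta> * u) * (1 / exp u)"
      unfolding pow_kernel_def by (intro mult_left_mono divide_left_mono) (auto intro!: add_pos_pos mult_pos_pos)
    also have "\<dots> = g (1 - \<beta>) u" using True by (simp add: g_def exp_diff algebra_simps)
    finally have "pow_kernel \<beta> u \<le> g (1 - \<beta>) u" .
    thus ?thesis using g0[of "1 - \<beta>" u] g0[of \<beta> "0 + (-1) * u"] k0 by simp
  next
    case False
    have "pow_kernel \<beta> u \<le> exp (\<beta> * u) * 1"
      unfolding pow_kernel_def by (intro mult_left_mono) (auto simp: add_pos_pos)
    thus ?thesis using False by (simp add: g_def pow_kernel_def add_nonneg_nonneg)
  qed
  ultimately show ?thesis by (blast intro: Bochner_Integration.integrable_bound)
qed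

text \<open>For exponents strictly between 0 and 1 the value is
  \<open>pi / sin (pi * \<beta>)\<close>.\<close>

definition pow_const :: "real \<Rightarrow> real" where
  "pow_const \<beta> = (\<integral>u. pow_kernel \<beta> u \<partial>lborel)"

text \<open>The kernel is nonnegative, and at least \<open>1 / (1 + exp 1)\<close> on the unit
  interval.\<close>

lemma pow_const_pos:
  assumes "0 < \<beta>" "\<beta> < 1"
  shows "pow_const \<beta> > 0"
proof -
  have "0 < 1 / (1 + exp 1 :: real)" by (simp add: add_pos_pos)
  also have "\<dots> = (\<integral>u. indicator {0..1::real} u * (1 / (1 + exp 1)) \<partial>lborel)" by simp
  also have "\<dots> \<le> pow_const \<beta>"
    unfolding pow_const_def
  proof (intro integral_mono pow_kernel_integrable assms)
    show "integrable lborel (\<lambda>u. indicator {0..1::real} u * (1 / (1 + exp 1 :: real)))"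
      by (intro integrable_mult_left integrable_real_indicator) auto
  next
    fix u :: real
    have "1 * (1 / (1 + exp 1)) \<le> exp (\<beta> * u) * (1 / (1 + exp u))" if "0 \<le> u" "u \<le> 1"
      using that assms by (intro mult_mono divide_left_mono) (auto simp: add_pos_pos)
    thus "indicator {0..1} u * (1 / (1 + exp 1)) \<le> pow_kernel \<beta> u"
      by (auto simp: pow_kernel_def indicator_def add_nonneg_nonneg)
  qed
  finally show ?thesis .
qed

text \<open>This is the integral of \<open>s powr (\<beta> - 1) * t / (t + s)\<close> over positive
  \<open>s\<close>, with \<open>s = exp u\<close>. In the variable \<open>u\<close>, scaling by
  \<open>t\<close> becomes a translation by \<open>ln t\<close>, which produces the factor
  \<open>t powr \<beta>\<close>.\<close>

lemma powr_integral:
  assumes b: "0 < \<beta>" "\<beta> < 1" and t: "t > 0"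
  shows "integrable lborel (\<lambda>u. exp (\<beta> * u) * (t / (t + exp u)))"
    and "(\<integral>u. exp (\<beta> * u) * (t / (t + exp u)) \<partial>lborel) = pow_const \<beta> * t powr \<beta>"
proof -
  have eq: "exp (\<beta> * u) * (t / (t + exp u)) = t powr \<beta> * pow_kernel \<beta> (- ln t + 1 * u)" for u
  proof -
    have 1: "exp (- ln t + 1 * u) = exp u / t" using t by (simp add: exp_diff)
    have 2: "exp (\<beta> * (- ln t + 1 * u)) * t powr \<beta> = exp (\<beta> * u)"
      using t by (simp add: powr_def exp_add[symmetric] algebra_simps)
    have "t / (t + exp u) = 1 / (1 + exp u / t)" using t by (simp add: field_simps)
    hence "exp (\<beta> * u) * (t / (t + exp u))
        = exp (\<beta> * (- ln t + 1 * u)) * t powr \<beta> * (1 / (1 + exp (- ln t + 1 * u)))"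
      by (simp only: 1 2)
    thus ?thesis by (simp only: pow_kernel_def mult.assoc mult.left_commute)
  qed
  show "integrable lborel (\<lambda>u. exp (\<beta> * u) * (t / (t + exp u)))"
    unfolding eq using b by (intro integrable_mult_right lborel_integrable_real_affine pow_kernel_integrable) auto
  have "(\<integral>u. pow_kernel \<beta> (- ln t + 1 * u) \<partial>lborel) = pow_const \<beta>"
    unfolding pow_const_def using lborel_integral_real_affine[of 1 "pow_kernel \<beta>" "- ln t"] by simp
  thus "(\<integral>u. exp (\<beta> * u) * (t / (t + exp u)) \<partial>lborel) = pow_const \<beta> * t powr \<beta>"
    unfolding eq by simp
qed

text \<open>The scalar case of the variational formula for a parallel sum, here of 1 and
  \<open>d / s\<close>: by the triangle inequality it reduces to moduli, where the deficit is a
  square.\<close>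

lemma weighted_split_lower_bound:
  fixes z w :: complex
  assumes "d > 0" "s > 0"
  shows "(cmod z)\<^sup>2 * (d / (d + s)) \<le> (cmod w)\<^sup>2 + d * (cmod (z - w))\<^sup>2 / s"
proof -
  define a where "a = cmod w"
  define b where "b = cmod (z - w)"
  have "cmod z \<le> a + b" unfolding a_def b_def by (metis add_diff_cancel_left' diff_add_cancel norm_triangle_sub)
  hence "(cmod z)\<^sup>2 * (d / (d + s)) \<le> (a + b)\<^sup>2 * (d / (d + s))"
    using assms by (intro mult_right_mono power_mono) auto
  also have "\<dots> = a\<^sup>2 + d * b\<^sup>2 / s - (s * a - d * b)\<^sup>2 / (s * (d + s))"
    using assms by (simp add: divide_simps power2_eq_square) (simp add: algebra_simps)
  also have "\<dots> \<le> a\<^sup>2 + d * b\<^sup>2 / s" using assms by simp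
  finally show ?thesis by (simp add: a_def b_def)
qed

text \<open>At this \<open>w\<close> the balance \<open>s * w = d * (z - w)\<close> holds, so the
  square subtracted in the lower bound vanishes.\<close>

lemma weighted_split_minimum:
  fixes z :: complex
  assumes "d > 0" "s > 0"
  defines "w \<equiv> complex_of_real (d / (d + s)) * z"
  shows "(cmod w)\<^sup>2 + d * (cmod (z - w))\<^sup>2 / s = (cmod z)\<^sup>2 * (d / (d + s))"
proof -
  have zw: "z - w = complex_of_real (s / (d + s)) * z"
  proof -
    have "s / (d + s) = 1 - d / (d + s)" using assms(1,2) by (simp add: field_simps)
    hence "complex_of_real (s / (d + s)) = 1 - complex_of_real (d / (d + s))"
      by (metis of_real_1 of_real_diff)
    thus ?thesis by (simp only: w_def left_diff_distrib mult_1)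
  qed
  have 1: "cmod w = d / (d + s) * cmod z" using assms(1,2) by (simp only: w_def norm_mult norm_of_real) simp
  have 2: "cmod (z - w) = s / (d + s) * cmod z" using assms(1,2) by (simp only: zw norm_mult norm_of_real) simp
  show ?thesis unfolding 1 2 using assms(1,2)
    by (simp add: power2_eq_square divide_simps) (simp add: algebra_simps)
qed

text \<open>The integrand is, up to the factor \<open>exp (\<beta> * u)\<close>, the quadratic form of the parallel sum of
  \<open>A\<close> and \<open>exp (- u) B\<close>, which is a minimum of expressions linear in \<open>(A, B)\<close>.\<close>

lemma gm_integral_representation:
  assumes A: "posdef A" and B: "posdef B" and b: "0 < \<beta>" "\<beta> < 1"
  obtains h where "integrable lborel (h :: real \<Rightarrow> real)"
    "(\<integral>u. h u \<partial>lborel) = pow_const \<beta> * Re (qform (gm \<beta> A B) x)"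
    "\<And>u y. h u \<le> exp (\<beta> * u) * (Re (qform A y) + Re (qform B (x - y)) / exp u)"
    "\<And>u. \<exists>y. h u = exp (\<beta> * u) * (Re (qform A y) + Re (qform B (x - y)) / exp u)"
proof -
  obtain S T d where *: "T ** S = mat 1" "S ** T = mat 1" "A = S ** adj S"
    "B = S ** diagm d ** adj S" and d: "\<And>i. d i > 0" using simultaneous_congruence[OF A B] by blast
  \<comment> \<open>In these coordinates both forms are diagonal, and the minimisation splits into
    one scalar problem per index.\<close>
  define z where "z = adj S *v x"
  define h where "h = (\<lambda>u. \<Sum>i\<in>UNIV. (cmod (z$i))\<^sup>2 * (exp (\<beta> * u) * (d i / (d i + exp u))))"
  have G: "Re (qform (gm \<beta> A B) x) = (\<Sum>i\<in>UNIV. d i powr \<beta> * (cmod (z$i))\<^sup>2)"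
    unfolding gm_congruence[OF *(1) A *(3,4)] qform_congruence qform_diagm z_def by simp
  have qA: "Re (qform A y) = (\<Sum>i\<in>UNIV. (cmod ((adj S *v y)$i))\<^sup>2)" for y
    using qform_congruence[of S "diagm (\<lambda>i. 1)" y] *(3) qform_diagm[of "\<lambda>i. 1" "adj S *v y"]
    by (simp add: diagm_one)
  have qB: "Re (qform B y) = (\<Sum>i\<in>UNIV. d i * (cmod ((adj S *v y)$i))\<^sup>2)" for y
    unfolding *(4) qform_congruence qform_diagm by simp
  have q: "exp (\<beta> * u) * (Re (qform A y) + Re (qform B (x - y)) / exp u)
     = (\<Sum>i\<in>UNIV. exp (\<beta> * u) * ((cmod ((adj S *v y)$i))\<^sup>2 + d i * (cmod (z$i - (adj S *v y)$i))\<^sup>2 / exp u))"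
    for u y
    unfolding qA qB by (simp add: z_def matrix_vector_mult_diff_distrib sum.distrib sum_distrib_left
        sum_divide_distrib distrib_left)
  show ?thesis
  proof
    show "integrable lborel h" unfolding h_def
      using powr_integral[OF b d] by (intro Bochner_Integration.integrable_sum integrable_mult_right) auto
    show "(\<integral>u. h u \<partial>lborel) = pow_const \<beta> * Re (qform (gm \<beta> A B) x)"
    proof -
      have "(\<integral>u. h u \<partial>lborel)
        = (\<Sum>i\<in>UNIV. \<integral>u. (cmod (z$i))\<^sup>2 * (exp (\<beta> * u) * (d i / (d i + exp u))) \<partial>lborel)"
        unfolding h_def using powr_integral(1)[OF b d]
        by (intro Bochner_Integration.integral_sum integrable_mult_right) auto
      also have "\<dots> = (\<Sum>i\<in>UNIV. (cmod (z$i))\<^sup>2 * (pow_const \<beta> * d i powr \<beta>))"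
        by (simp only: integral_mult_right_zero powr_integral(2)[OF b d])
      finally show ?thesis by (simp add: G sum_distrib_left mult_ac)
    qed
    show "h u \<le> exp (\<beta> * u) * (Re (qform A y) + Re (qform B (x - y)) / exp u)" for u y
      unfolding q h_def
    proof (rule sum_mono)
      fix i
      show "(cmod (z $ i))\<^sup>2 * (exp (\<beta> * u) * (d i / (d i + exp u)))
         \<le> exp (\<beta> * u) * ((cmod ((adj S *v y) $ i))\<^sup>2 + d i * (cmod (z $ i - (adj S *v y) $ i))\<^sup>2 / exp u)"
        using mult_left_mono[OF weighted_split_lower_bound[OF d[of i] exp_gt_zero[of u], of "z$i" "(adj S *v y)$i"],
            of "exp (\<beta> * u)"]
        by (simp add: mult.left_commute)
    qed
    show "\<exists>y. h u = exp (\<beta> * u) * (Re (qform A y) + Re (qform B (x - y)) / exp u)" for u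
    proof -
      \<comment> \<open>The scalar minimisers, taken coordinate by coordinate; \<open>adj T\<close>
        pulls them back to a single vector.\<close>
      define w where "w = (\<chi> i. complex_of_real (d i / (d i + exp u)) * z $ i)"
      have "adj S ** adj T = mat 1" using *(1) by (metis adj_mult adj_mat complex_cnj_one)
      hence w: "adj S *v (adj T *v w) = w" by (simp add: matrix_vector_mul_assoc)
      show ?thesis
      proof (rule exI[of _ "adj T *v w"], unfold q h_def w, rule sum.cong[OF refl])
        fix i
        show "(cmod (z $ i))\<^sup>2 * (exp (\<beta> * u) * (d i / (d i + exp u)))
          = exp (\<beta> * u) * ((cmod (w $ i))\<^sup>2 + d i * (cmod (z $ i - w $ i))\<^sup>2 / exp u)"
          using weighted_split_minimum[OF d[of i] exp_gt_zero[of u], of "z$i"]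
          unfolding w_def vec_lambda_beta by (metis mult.left_commute)
      qed
    qed
  qed
qed

text \<open>Monotonicity, joint concavity and the transformer inequality for the geometric mean are all
  instances.\<close>

lemma gm_superadditive_congruence:
  fixes K1 K2 :: "('n::finite) cmat"
  assumes pd: "posdef A1" "posdef B1" "posdef A2" "posdef B2" "posdef A" "posdef B"
    and b: "0 < \<beta>" "\<beta> < 1"
    and A: "\<And>y. Re (qform A1 (K1 *v y)) + Re (qform A2 (K2 *v y)) \<le> Re (qform A y)"
    and B: "\<And>y. Re (qform B1 (K1 *v y)) + Re (qform B2 (K2 *v y)) \<le> Re (qform B y)"
  shows "Re (qform (gm \<beta> A1 B1) (K1 *v x)) + Re (qform (gm \<beta> A2 B2) (K2 *v x)) \<le> Re (qform (gm \<beta> A B) x)"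
proof -
  obtain h1 where h1: "integrable lborel (h1 :: real \<Rightarrow> real)"
    "(\<integral>u. h1 u \<partial>lborel) = pow_const \<beta> * Re (qform (gm \<beta> A1 B1) (K1 *v x))"
    "\<And>u y. h1 u \<le> exp (\<beta> * u) * (Re (qform A1 y) + Re (qform B1 (K1 *v x - y)) / exp u)"
    using gm_integral_representation[OF pd(1,2) b] by metis
  obtain h2 where h2: "integrable lborel (h2 :: real \<Rightarrow> real)"
    "(\<integral>u. h2 u \<partial>lborel) = pow_const \<beta> * Re (qform (gm \<beta> A2 B2) (K2 *v x))"
    "\<And>u y. h2 u \<le> exp (\<beta> * u) * (Re (qform A2 y) + Re (qform B2 (K2 *v x - y)) / exp u)"
    using gm_integral_representation[OF pd(3,4) b] by metis
  obtain h where h: "integrable lborel (h :: real \<Rightarrow> real)"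
    "(\<integral>u. h u \<partial>lborel) = pow_const \<beta> * Re (qform (gm \<beta> A B) x)"
    "\<And>u. \<exists>y. h u = exp (\<beta> * u) * (Re (qform A y) + Re (qform B (x - y)) / exp u)"
    using gm_integral_representation[OF pd(5,6) b] by metis
  have "h1 u + h2 u \<le> h u" for u
  proof -
    \<comment> \<open>The minimiser \<open>y\<close> for the pair \<open>A\<close>, \<open>B\<close>
      supplies the trial vectors \<open>K1 *v y\<close> and \<open>K2 *v y\<close> for the other two
      minima.\<close>
    obtain y where y: "h u = exp (\<beta> * u) * (Re (qform A y) + Re (qform B (x - y)) / exp u)" using h(3) by blast
    have "h1 u + h2 u \<le> exp (\<beta> * u) * (Re (qform A1 (K1 *v y)) + Re (qform B1 (K1 *v (x - y))) / exp u)
      + exp (\<beta> * u) * (Re (qform A2 (K2 *v y)) + Re (qform B2 (K2 *v (x - y))) / exp u)"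
      using add_mono[OF h1(3)[of u "K1 *v y"] h2(3)[of u "K2 *v y"]]
      by (simp add: matrix_vector_mult_diff_distrib)
    also have "\<dots> = exp (\<beta> * u) * ((Re (qform A1 (K1 *v y)) + Re (qform A2 (K2 *v y)))
       + (Re (qform B1 (K1 *v (x - y))) + Re (qform B2 (K2 *v (x - y)))) / exp u)"
      by (simp add: algebra_simps add_divide_distrib)
    also have "\<dots> \<le> h u" unfolding y using A B
      by (intro mult_left_mono add_mono divide_right_mono) auto
    finally show ?thesis .
  qed
  hence "(\<integral>u. h1 u + h2 u \<partial>lborel) \<le> (\<integral>u. h u \<partial>lborel)"
    using h1 h2 h by (intro integral_mono) auto
  hence "pow_const \<beta> * (Re (qform (gm \<beta> A1 B1) (K1 *v x)) + Re (qform (gm \<beta> A2 B2) (K2 *v x)))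
    \<le> pow_const \<beta> * Re (qform (gm \<beta> A B) x)"
    using h1 h2 h by (simp add: algebra_simps)
  thus ?thesis using pow_const_pos[OF b] by simp
qed

subsection \<open>The geometric mean of positive semidefinite matrices\<close>

lemma qform_zero_vec [simp]: "qform A 0 = 0" by (simp add: qform_def)
lemma qform_zero_mat [simp]: "qform 0 v = 0" by (simp add: qform_def)

lemma psd_qform_nonneg: "psd A \<Longrightarrow> 0 \<le> Re (qform A v)" by (simp add: psd_def)

lemma psd_zero: "psd 0" by (simp add: psd_def)

lemma psd_add: "psd A \<Longrightarrow> psd B \<Longrightarrow> psd (A + B)"
  by (simp add: psd_def qform_add)

lemma psd_congruence: "psd A \<Longrightarrow> psd (K ** A ** adj K)"
  by (simp add: psd_def qform_congruence)

lemma loewner_le_trans: "loewner_le A B \<Longrightarrow> loewner_le B C \<Longrightarrow> loewner_le A C"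
  using psd_add[of "B - A" "C - B"] by (simp add: loewner_le_def)

lemma loewner_leI:
  assumes "psd A" "psd B" "\<And>v. Re (qform A v) \<le> Re (qform B v)"
  shows "loewner_le A B"
  using assms by (auto simp: loewner_le_def psd_iff adj_diff qform_diff)

lemma loewner_le_congruence:
  assumes "loewner_le A B"
  shows "loewner_le (K ** A ** adj K) (K ** B ** adj K)"
proof -
  have "K ** (B - A) ** adj K = K ** B ** adj K - K ** A ** adj K"
    by (simp add: vec_eq_iff matrix_matrix_mult_def algebra_simps sum_subtractf)
  thus ?thesis using assms psd_congruence[of "B - A" K] by (simp add: loewner_le_def)
qed

lemma posdef_mat_one: "posdef (mat 1)"
  using posdef_add_mat[OF psd_zero, of 1] by simp

text \<open>The two-term inequality with \<open>K1\<close> the identity and \<open>K2 = 0\<close>,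
  which removes the second pair.\<close>

lemma gm_mono:
  assumes "posdef A" "posdef B" "posdef A'" "posdef B'" "0 < \<beta>" "\<beta> < 1"
    "\<And>y. Re (qform A y) \<le> Re (qform A' y)" "\<And>y. Re (qform B y) \<le> Re (qform B' y)"
  shows "Re (qform (gm \<beta> A B) x) \<le> Re (qform (gm \<beta> A' B') x)"
  using gm_superadditive_congruence[OF assms(1,2) posdef_mat_one posdef_mat_one assms(3-6),
      of "mat 1" 0 x] assms(7,8) by simp

lemma qform_tendsto:
  assumes "(F \<longlongrightarrow> L) net" shows "((\<lambda>e. qform (F e) v) \<longlongrightarrow> qform L v) net"
  unfolding qform_def matrix_vector_mult_def vec_lambda_beta
  by (intro tendsto_intros tendsto_vec_nth assms)

text \<open>By polarisation each entry is a fixed linear combination of four values of the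
  form.\<close>

lemma tendsto_of_qform_tendsto:
  fixes F :: "'e \<Rightarrow> ('n::finite) cmat"
  assumes "\<And>v. \<exists>l. ((\<lambda>e. qform (F e) v) \<longlongrightarrow> l) net"
  shows "\<exists>L. (F \<longlongrightarrow> L) net"
proof -
  obtain l where l: "\<And>v. ((\<lambda>e. qform (F e) v) \<longlongrightarrow> l v) net" using assms by metis
  define L :: "'n cmat" where "L = (\<chi> i j. (l (axis i 1 + axis j 1) - l (axis i 1 + (-1) *s axis j 1)
    - \<i> * l (axis i 1 + \<i> *s axis j 1) + \<i> * l (axis i 1 + (-\<i>) *s axis j 1)) / 4)"
  have p: "F e $ i $ j = (qform (F e) (axis i 1 + axis j 1) - qform (F e) (axis i 1 + (-1) *s axis j 1)
    - \<i> * qform (F e) (axis i 1 + \<i> *s axis j 1) + \<i> * qform (F e) (axis i 1 + (-\<i>) *s axis j 1)) / 4" for e i j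
    unfolding polarisation[of "F e" i j, symmetric] by simp
  have "(F \<longlongrightarrow> L) net"
  proof (intro vec_tendstoI)
    fix i j show "((\<lambda>e. F e $ i $ j) \<longlongrightarrow> L $ i $ j) net"
      unfolding p L_def vec_lambda_beta by (intro tendsto_intros l) simp
  qed
  thus ?thesis by blast
qed

lemma tendsto_Inf_at_right:
  fixes g :: "real \<Rightarrow> real"
  assumes mono: "\<And>a b. 0 < a \<Longrightarrow> a \<le> b \<Longrightarrow> g a \<le> g b" and nonneg: "\<And>a. 0 < a \<Longrightarrow> 0 \<le> g a"
  shows "(g \<longlongrightarrow> Inf (g ` {0<..})) (at_right 0)"
proof -
  have bdd: "bdd_below (g ` {0<..})" using nonneg by (auto intro!: bdd_belowI[of _ 0])
  show ?thesis
  proof (rule decreasing_tendsto)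
    show "eventually (\<lambda>e. Inf (g ` {0<..}) \<le> g e) (at_right 0)"
      using eventually_at_right_less[of 0] by eventually_elim (auto intro!: cInf_lower bdd)
  next
    fix x assume "Inf (g ` {0<..}) < x"
    then obtain a where a: "a > 0" "g a < x"
      using cInf_less_iff[OF _ bdd, of x] by auto
    have "eventually (\<lambda>e. e \<in> {0<..<a}) (at_right 0)" using a by (intro eventually_at_right_real)
    thus "eventually (\<lambda>e. g e < x) (at_right 0)"
    proof eventually_elim
      case (elim e)
      thus ?case using mono[of e a] a(2) by simp
    qed
  qed
qed

text \<open>Each quadratic form of the regularised mean is nonnegative and monotone in \<epsilon>,
  hence converges as \<epsilon> decreases to 0. So the \<open>Lim\<close> in \<open>gmean\<close> is
  a genuine limit rather than an unspecified value.\<close>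

lemma gmean_tendsto:
  assumes A: "psd A" and B: "psd B" and b: "0 < \<beta>" "\<beta> < 1"
  shows "((\<lambda>\<epsilon>. gm \<beta> (A + mat (complex_of_real \<epsilon>)) (B + mat (complex_of_real \<epsilon>))) \<longlongrightarrow> gmean \<beta> A B) (at_right 0)"
proof -
  define F where "F = (\<lambda>\<epsilon>. gm \<beta> (A + mat (complex_of_real \<epsilon>)) (B + mat (complex_of_real \<epsilon>)))"
  have psdF: "psd (F \<epsilon>)" if "\<epsilon> > 0" for \<epsilon>
    unfolding F_def using that A B by (intro gm_psd posdef_add_mat)
  have mono: "Re (qform (F a) v) \<le> Re (qform (F b) v)" if "0 < a" "a \<le> b" for a b v
    unfolding F_def using that A B
    by (intro gm_mono posdef_add_mat b) (auto simp: qform_add qform_mat intro!: mult_right_mono)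
  have "\<exists>l. ((\<lambda>\<epsilon>. qform (F \<epsilon>) v) \<longlongrightarrow> l) (at_right 0)" for v
  proof -
    have "((\<lambda>\<epsilon>. Re (qform (F \<epsilon>) v)) \<longlongrightarrow> Inf ((\<lambda>\<epsilon>. Re (qform (F \<epsilon>) v)) ` {0<..})) (at_right 0)"
      using mono psd_qform_nonneg[OF psdF] by (intro tendsto_Inf_at_right) auto
    hence "((\<lambda>\<epsilon>. complex_of_real (Re (qform (F \<epsilon>) v)))
        \<longlongrightarrow> complex_of_real (Inf ((\<lambda>\<epsilon>. Re (qform (F \<epsilon>) v)) ` {0<..}))) (at_right 0)"
      by (rule tendsto_of_real)
    moreover have "eventually (\<lambda>\<epsilon>. complex_of_real (Re (qform (F \<epsilon>) v)) = qform (F \<epsilon>) v) (at_right 0)"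
      using eventually_at_right_less[of 0]
      by eventually_elim (use psdF psd_iff hermitian_qform_real in metis)
    ultimately show ?thesis by (blast intro: Lim_transform_eventually)
  qed
  from tendsto_of_qform_tendsto[OF this] obtain L where L: "(F \<longlongrightarrow> L) (at_right 0)" by blast
  have "gmean \<beta> A B = Lim (at_right 0) F" by (simp add: gmean_def F_def gm_def Let_def)
  also have "\<dots> = L" using L by (intro tendsto_Lim) auto
  finally show ?thesis using L by (simp add: F_def)
qed

lemma gmean_psd:
  assumes "psd A" "psd B" "0 < \<beta>" "\<beta> < 1"
  shows "psd (gmean \<beta> A B)"
  unfolding psd_def
proof (intro allI conjI)
  fix v
  note t = qform_tendsto[OF gmean_tendsto[OF assms], of v]
  have e: "eventually (\<lambda>\<epsilon>. psd (gm \<beta> (A + mat (complex_of_real \<epsilon>)) (B + mat (complex_of_real \<epsilon>)))) (at_right 0)"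
    using eventually_at_right_less[of 0]
    by eventually_elim (use assms in \<open>auto intro!: gm_psd posdef_add_mat\<close>)
  show "qform (gmean \<beta> A B) v \<in> \<real>"
    by (rule Lim_in_closed_set[OF closed_complex_Reals _ _ t]) (use e in \<open>auto simp: psd_def elim: eventually_mono\<close>)
  show "0 \<le> Re (qform (gmean \<beta> A B) v)"
    by (rule tendsto_lowerbound[OF tendsto_Re[OF t]]) (use e in \<open>auto simp: psd_def elim: eventually_mono\<close>)
qed

lemma matrix_vector_norm_bound:
  fixes K :: "('n::finite) cmat"
  obtains c where "c > 0" "\<And>y. (norm (K *v y))\<^sup>2 \<le> c * (norm y)\<^sup>2"
proof -
  have "bounded_linear ((*v) K)" by simp
  then obtain c where c: "c > 0" "\<And>y. norm (K *v y) \<le> norm y * c" using bounded_linear.pos_bounded by blast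
  have "(norm (K *v y))\<^sup>2 \<le> c\<^sup>2 * (norm y)\<^sup>2" for y
    using power_mono[OF c(2)[of y] norm_ge_zero, of 2] by (simp add: power_mult_distrib mult.commute)
  thus ?thesis using that[of "c\<^sup>2"] c(1) by simp
qed

text \<open>Regularising the left-hand pairs by \<epsilon> adds \<epsilon> times the squared norms
  of \<open>K1 *v y\<close> and \<open>K2 *v y\<close>. Regularising the right-hand pair by
  \<open>c * \<epsilon>\<close> absorbs this, and \<open>c * \<epsilon>\<close> also tends to 0 from
  the right.\<close>

lemma gmean_superadditive_congruence:
  fixes K1 K2 :: "('n::finite) cmat"
  assumes psd: "psd A1" "psd B1" "psd A2" "psd B2" "psd A" "psd B"
    and b: "0 < \<beta>" "\<beta> < 1"
    and A: "\<And>y. Re (qform A1 (K1 *v y)) + Re (qform A2 (K2 *v y)) \<le> Re (qform A y)"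
    and B: "\<And>y. Re (qform B1 (K1 *v y)) + Re (qform B2 (K2 *v y)) \<le> Re (qform B y)"
  shows "Re (qform (gmean \<beta> A1 B1) (K1 *v x)) + Re (qform (gmean \<beta> A2 B2) (K2 *v x)) \<le> Re (qform (gmean \<beta> A B) x)"
proof -
  obtain c1 where c1: "c1 > 0" "\<And>y. (norm (K1 *v y))\<^sup>2 \<le> c1 * (norm y)\<^sup>2"
    using matrix_vector_norm_bound[of K1] by blast
  obtain c2 where c2: "c2 > 0" "\<And>y. (norm (K2 *v y))\<^sup>2 \<le> c2 * (norm y)\<^sup>2"
    using matrix_vector_norm_bound[of K2] by blast
  define c where "c = c1 + c2"
  have c: "c > 0" using c1 c2 by (simp add: c_def)
  define F where "F = (\<lambda>A B \<epsilon>. gm \<beta> (A + mat (complex_of_real \<epsilon>)) (B + mat (complex_of_real \<epsilon>) :: 'n cmat))"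
  have lim: "((\<lambda>\<epsilon>. Re (qform (F A B \<epsilon>) v)) \<longlongrightarrow> Re (qform (gmean \<beta> A B) v)) (at_right 0)"
    if "psd A" "psd B" for A B v
    unfolding F_def by (intro tendsto_Re qform_tendsto gmean_tendsto that b)
  have pert: "Re (qform (X1 + mat (complex_of_real \<epsilon>)) (K1 *v y)) + Re (qform (X2 + mat (complex_of_real \<epsilon>)) (K2 *v y))
      \<le> Re (qform (X + mat (complex_of_real (c * \<epsilon>))) y)"
    if "\<epsilon> > 0" "\<And>y. Re (qform X1 (K1 *v y)) + Re (qform X2 (K2 *v y)) \<le> Re (qform X y)" for X1 X2 X \<epsilon> y
  proof -
    have "\<epsilon> * ((norm (K1 *v y))\<^sup>2 + (norm (K2 *v y))\<^sup>2) \<le> \<epsilon> * (c * (norm y)\<^sup>2)"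
      using c1(2)[of y] c2(2)[of y] that(1) by (intro mult_left_mono) (auto simp: c_def algebra_simps)
    moreover have "Re (qform X1 (K1 *v y)) + Re (qform X2 (K2 *v y)) \<le> Re (qform X y)" by (rule that)
    moreover have q: "Re (qform (Z + mat (complex_of_real e)) w) = Re (qform Z w) + e * (norm w)\<^sup>2" for Z e and w :: "complex^'n"
      unfolding qform_add qform_mat of_real_mult[symmetric] by simp
    ultimately show ?thesis unfolding q by (simp add: algebra_simps)
  qed
  have le: "Re (qform (F A1 B1 \<epsilon>) (K1 *v x)) + Re (qform (F A2 B2 \<epsilon>) (K2 *v x)) \<le> Re (qform (F A B (c * \<epsilon>)) x)"
    if "\<epsilon> > 0" for \<epsilon>
    unfolding F_def using that c A B
    by (intro gm_superadditive_congruence posdef_add_mat psd b pert) auto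
  have sc: "filterlim (\<lambda>\<epsilon>. c * \<epsilon>) (at_right 0) (at_right (0::real))"
    using filterlim_times_pos[OF filterlim_ident c, of 0 0] by simp
  show ?thesis
  proof (rule tendsto_le[OF trivial_limit_at_right_real])
    show "((\<lambda>\<epsilon>. Re (qform (F A B (c * \<epsilon>)) x)) \<longlongrightarrow> Re (qform (gmean \<beta> A B) x)) (at_right 0)"
      using filterlim_compose[OF lim[OF psd(5,6)] sc] .
    show "((\<lambda>\<epsilon>. Re (qform (F A1 B1 \<epsilon>) (K1 *v x)) + Re (qform (F A2 B2 \<epsilon>) (K2 *v x))) \<longlongrightarrow>
      Re (qform (gmean \<beta> A1 B1) (K1 *v x)) + Re (qform (gmean \<beta> A2 B2) (K2 *v x))) (at_right 0)"
      by (intro tendsto_add lim psd)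
    show "eventually (\<lambda>\<epsilon>. Re (qform (F A1 B1 \<epsilon>) (K1 *v x)) + Re (qform (F A2 B2 \<epsilon>) (K2 *v x))
       \<le> Re (qform (F A B (c * \<epsilon>)) x)) (at_right 0)"
      using eventually_at_right_less[of 0] by eventually_elim (rule le)
  qed
qed

text \<open>Take \<open>K1 = adj K\<close> and let the second term vanish; the form of a congruence
  is the original form evaluated at \<open>adj K *v v\<close>.\<close>

lemma gmean_transformer:
  assumes "psd A" "psd B" "0 < \<beta>" "\<beta> < 1"
  shows "loewner_le (K ** gmean \<beta> A B ** adj K) (gmean \<beta> (K ** A ** adj K) (K ** B ** adj K))"
proof (rule loewner_leI)
  show "psd (K ** gmean \<beta> A B ** adj K)" "psd (gmean \<beta> (K ** A ** adj K) (K ** B ** adj K))"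
    using assms by (auto intro!: psd_congruence gmean_psd)
  show "Re (qform (K ** gmean \<beta> A B ** adj K) v) \<le> Re (qform (gmean \<beta> (K ** A ** adj K) (K ** B ** adj K)) v)" for v
    using gmean_superadditive_congruence[OF assms(1,2) psd_zero psd_zero psd_congruence[OF assms(1)]
        psd_congruence[OF assms(2)] assms(3,4), of "adj K" 0 K K v]
    by (simp add: qform_congruence)
qed

lemma qform_scaleR: "qform (c *\<^sub>R A) v = c *\<^sub>R qform A v"
  by (simp add: qform_def matrix_vector_mult_def scaleR_sum_right sum_distrib_left)

lemma psd_scaleR: "psd A \<Longrightarrow> c \<ge> 0 \<Longrightarrow> psd (c *\<^sub>R A)"
  by (simp add: psd_def qform_scaleR complex_is_Real_iff)

text \<open>Choose \<open>K1\<close> and \<open>K2\<close> as the scalars \<open>sqrt l\<close> and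
  \<open>sqrt m\<close>. Since \<open>l + m = 1\<close>, the two left-hand arguments recombine to
  \<sigma>.\<close>

lemma gmean_concave_right:
  assumes \<sigma>: "psd \<sigma>" and A: "psd A" and B: "psd B" and b: "0 < \<beta>" "\<beta> < 1"
    and l: "0 \<le> l" "0 \<le> m" "l + m = 1"
  shows "loewner_le (l *\<^sub>R gmean \<beta> \<sigma> A + m *\<^sub>R gmean \<beta> \<sigma> B) (gmean \<beta> \<sigma> (l *\<^sub>R A + m *\<^sub>R B))"
proof (rule loewner_leI)
  show "psd (l *\<^sub>R gmean \<beta> \<sigma> A + m *\<^sub>R gmean \<beta> \<sigma> B)" "psd (gmean \<beta> \<sigma> (l *\<^sub>R A + m *\<^sub>R B))"
    using assms by (auto intro!: psd_add psd_scaleR gmean_psd)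
  fix v
  define K where "K = (\<lambda>r. mat (complex_of_real (sqrt r)) :: 'a cmat)"
  have q: "Re (qform X (K r *v w)) = r * Re (qform X w)" if "r \<ge> 0" for X r w
  proof -
    have "K r *v w = complex_of_real (sqrt r) *s w"
      by (simp add: K_def vec_eq_iff matrix_vector_mult_def mat_def if_distrib[of "\<lambda>z. z * _"] sum.delta cong: if_cong)
    thus ?thesis using that by (simp add: qform_smult norm_of_real)
  qed
  show "Re (qform (l *\<^sub>R gmean \<beta> \<sigma> A + m *\<^sub>R gmean \<beta> \<sigma> B) v) \<le> Re (qform (gmean \<beta> \<sigma> (l *\<^sub>R A + m *\<^sub>R B)) v)"
    using gmean_superadditive_congruence[OF \<sigma> A \<sigma> B \<sigma> psd_add[OF psd_scaleR[OF A l(1)] psd_scaleR[OF B l(2)]] b,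
        of "K l" "K m" v] l
    by (simp add: q qform_add qform_scaleR distrib_right[symmetric])
qed

subsection \<open>Trace, operator norm and the minimax argument\<close>

lemma trace_qform: "trace A = (\<Sum>i\<in>UNIV. qform A (axis i 1))"
  by (simp add: trace_def qform_axis)

lemma trace_mult_commute: "trace (A ** B) = trace (B ** A)"
  unfolding trace_def matrix_matrix_mult_def vec_lambda_beta
  by (subst sum.swap) (simp add: mult.commute)

lemma trace_add: "trace (A + B) = trace A + trace B"
  by (simp add: trace_def sum.distrib)

lemma trace_scaleR: "trace (c *\<^sub>R A) = complex_of_real c * trace A"
  by (simp add: trace_def sum_distrib_left scaleR_conv_of_real[where 'a=complex])

lemma psd_trace_nonneg: "psd A \<Longrightarrow> 0 \<le> Re (trace A)"
  by (simp add: trace_qform sum_nonneg psd_qform_nonneg)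

lemma psd_trace_real:
  assumes "psd A" shows "trace A = complex_of_real (Re (trace A))"
proof -
  have "qform A v = complex_of_real (Re (qform A v))" for v
    using assms psd_iff hermitian_qform_real by blast
  thus ?thesis unfolding trace_qform by (metis (no_types, lifting) Re_sum of_real_sum sum.cong)
qed

lemma Re_qform_le_opnorm: "Re (qform R v) \<le> opnorm R * (norm v)\<^sup>2"
proof -
  have "Re (qform R v) = v \<bullet> (R *v v)" by (simp add: qform_hin inner_eq_Re_hin)
  also have "\<dots> \<le> norm v * norm (R *v v)" by (rule norm_cauchy_schwarz)
  also have "\<dots> \<le> norm v * (opnorm R * norm v)"
    unfolding opnorm_def by (intro mult_left_mono onorm) auto
  finally show ?thesis by (simp add: power2_eq_square mult_ac)
qed

lemma square_root_norm:
  assumes "psd A"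
  shows "(norm (mpow A (1/2) *v v))\<^sup>2 = Re (qform A v)"
proof -
  define P where "P = mpow A (1/2)"
  note P = mpow_half_psd[OF assms, folded P_def]
  have "qform A v = hin (P *v v) (P *v v)"
    by (subst P(2)[symmetric]) (simp add: qform_hin matrix_vector_mul_assoc[symmetric] hin_adj P(1))
  thus ?thesis by (simp add: hin_self P_def)
qed

text \<open>With \<open>P\<close> the square root of \<open>R\<close>, the squared norm of
  \<open>R *v v\<close> is the form of \<open>R\<close> at \<open>P *v v\<close>, so the bound on
  the form can be applied twice.\<close>

lemma opnorm_le:
  assumes R: "psd R" and r: "\<And>v. Re (qform R v) \<le> r * (norm v)\<^sup>2"
  shows "opnorm R \<le> r"
proof -
  \<comment> \<open>Names an index: the form at the corresponding basis vector lies between 0 and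
    \<open>r\<close>.\<close>
  obtain k :: 'a where True by simp
  have r0: "0 \<le> r" using r[of "axis k 1"] psd_qform_nonneg[OF R, of "axis k 1"] by simp
  define P where "P = mpow R (1/2)"
  note P = mpow_half_psd[OF R, folded P_def]
  note sq = square_root_norm[OF R, folded P_def]
  have "norm (R *v v) \<le> r * norm v" for v
  proof (rule power2_le_imp_le)
    have "(norm (R *v v))\<^sup>2 = (norm (P *v (P *v v)))\<^sup>2" by (simp add: matrix_vector_mul_assoc P(2))
    also have "\<dots> \<le> r * (norm (P *v v))\<^sup>2" unfolding sq[of "P *v v"] by (rule r)
    also have "\<dots> \<le> r * (r * (norm v)\<^sup>2)" unfolding sq using r r0 by (intro mult_left_mono)
    finally show "(norm (R *v v))\<^sup>2 \<le> (r * norm v)\<^sup>2" by (simp add: power2_eq_square mult_ac)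
  qed (use r0 in simp)
  thus ?thesis unfolding opnorm_def by (rule onorm_le)
qed

lemma trace_square_root_sandwich:
  assumes "psd \<omega>"
  shows "trace (mpow \<omega> (1/2) ** R ** mpow \<omega> (1/2)) = trace (\<omega> ** R)"
proof -
  have "trace (mpow \<omega> (1/2) ** R ** mpow \<omega> (1/2)) = trace (mpow \<omega> (1/2) ** mpow \<omega> (1/2) ** R)"
    by (subst trace_mult_commute) (simp add: matrix_mul_assoc)
  thus ?thesis using mpow_half_psd[OF assms] by simp
qed

text \<open>The trace is the sum of the forms of \<open>R\<close> at the columns of the square root
  of \<omega>, whose squared norms add up to the trace of \<omega>.\<close>

lemma trace_psd_mult_le:
  assumes w: "psd \<omega>" and c: "\<And>v. Re (qform R v) \<le> c * (norm v)\<^sup>2"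
  shows "Re (trace (\<omega> ** R)) \<le> c * Re (trace \<omega>)"
proof -
  define P where "P = mpow \<omega> (1/2)"
  note P = mpow_half_psd[OF w, folded P_def]
  have "Re (trace (\<omega> ** R)) = (\<Sum>i\<in>UNIV. Re (qform (P ** R ** adj P) (axis i 1)))"
    unfolding trace_square_root_sandwich[OF w, of R, symmetric, folded P_def]
    by (simp add: trace_qform P(1))
  also have "\<dots> \<le> (\<Sum>i\<in>UNIV. c * (norm (P *v axis i 1))\<^sup>2)"
    unfolding qform_congruence unfolding P(1) by (intro sum_mono c)
  also have "\<dots> = c * Re (trace \<omega>)"
    unfolding P_def square_root_norm[OF w] trace_qform by (simp add: sum_distrib_left)
  finally show ?thesis .
qed

lemma density_trace_le_opnorm:
  assumes "\<omega> \<in> density" shows "Re (trace (\<omega> ** R)) \<le> opnorm R"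
  using trace_psd_mult_le[of \<omega> R "opnorm R"] Re_qform_le_opnorm assms by (auto simp: density_def)

lemma trace_psd_mult_nonneg:
  assumes "psd \<omega>" "psd R" shows "0 \<le> Re (trace (\<omega> ** R))"
  unfolding trace_square_root_sandwich[OF assms(1), symmetric]
  using psd_trace_nonneg[OF psd_congruence[OF assms(2), of "mpow \<omega> (1/2)"]] mpow_half_psd[OF assms(1)] by simp

lemma psd_trace_zero:
  assumes A: "psd A" and tr: "Re (trace A) = 0" shows "A = 0"
proof -
  define P where "P = mpow A (1/2)"
  have "(\<Sum>i\<in>UNIV. (norm (P *v axis i 1))\<^sup>2) = 0"
    using tr unfolding P_def square_root_norm[OF A] trace_qform by simp
  hence P0: "P *v axis i 1 = 0" for i by (simp add: sum_nonneg_eq_0_iff)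
  have "P $ i $ j = 0" for i j using mult_axis[of P j i] P0[of j] by simp
  hence "P = 0" by (simp add: vec_eq_iff)
  thus ?thesis using mpow_half_psd(2)[OF A, folded P_def] by simp
qed

section \<open>Separating hyperplanes and densities\<close>

lemma inner_cmat: "A \<bullet> B = Re (trace (adj A ** B))"
  unfolding inner_vec_def trace_def matrix_matrix_mult_def
  by (subst sum.swap) (simp add: inner_complex_def)

lemma inner_adj: "A \<bullet> adj B = adj A \<bullet> B"
  unfolding inner_vec_def by (subst sum.swap) (simp add: inner_complex_def)

text \<open>The cone of admissible \<open>Z\<close> constrains only the real part of the form, so it
  contains every anti-Hermitian matrix together with its negative; this forces \<open>a\<close> to
  be Hermitian. The negative rank-one matrices then give positivity.\<close>

lemma inner_dual_cone_psd:
  fixes a :: "('n::finite) cmat"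
  assumes dual: "\<And>Z. (\<And>v. Re (qform Z v) \<le> 0) \<Longrightarrow> a \<bullet> Z \<le> 0"
  shows "psd a"
proof -
  have "(a - adj a) \<bullet> Y = 0" for Y
  proof -
    have q: "Re (qform (Y - adj Y) v) = 0" for v
      using hin_adj[of v "adj Y" v] cnj_hin[of "Y *v v" v] by (simp add: qform_diff)
        (metis adj_adj cnj.simps(1) qform_hin)
    have "a \<bullet> (Y - adj Y) \<le> 0" using q by (intro dual) simp
    moreover have "a \<bullet> (- (Y - adj Y)) \<le> 0"
    proof (rule dual)
      show "Re (qform (- (Y - adj Y)) v) \<le> 0" for v using q[of v] qform_diff[of 0 "Y - adj Y" v] by simp
    qed
    ultimately show ?thesis by (simp add: inner_diff_right inner_diff_left inner_adj)
  qed
  hence "a - adj a = 0" by (metis inner_eq_zero_iff)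
  hence h: "adj a = a" by simp
  moreover have "0 \<le> Re (qform a v)" for v
  proof -
    define Z :: "'n cmat" where "Z = (\<chi> i j. - (v $ i * cnj (v $ j)))"
    have "Z *v w = (- hin v w) *s v" for w
      by (simp add: vec_eq_iff matrix_vector_mult_def Z_def hin_def sum_distrib_left sum_negf mult_ac)
    hence "qform Z w = - (hin v w * cnj (hin v w))" for w
      by (simp only: qform_hin hin_smult_right cnj_hin) simp
    hence "Re (qform Z w) \<le> 0" for w by (simp add: complex_mult_cnj)
    hence "a \<bullet> Z \<le> 0" by (rule dual)
    moreover have "a \<bullet> Z = - Re (qform a v)"
    proof -
      have "trace (adj a ** Z) = - (\<Sum>i\<in>UNIV. \<Sum>j\<in>UNIV. a $ i $ j * (v $ j * cnj (v $ i)))"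
        by (simp add: h trace_def matrix_matrix_mult_def Z_def sum_negf)
      also have "\<dots> = - qform a v"
        by (simp add: qform_def matrix_vector_mult_def sum_distrib_left mult_ac)
      finally show ?thesis by (simp add: inner_cmat)
    qed
    ultimately show ?thesis by simp
  qed
  ultimately show ?thesis by (simp add: psd_iff)
qed

lemma maximally_mixed_density: "(1 / real CARD('n)) *\<^sub>R mat 1 \<in> (density :: ('n::finite) cmat set)"
proof -
  have "trace (mat 1 :: 'n cmat) = of_nat CARD('n)" by (simp add: trace_def mat_def)
  thus ?thesis using psd_scaleR[OF posdef_psd[OF posdef_mat_one], of "1 / real CARD('n)"]
    by (simp add: density_def trace_scaleR)
qed

lemma minimax_density:
  fixes C :: "('n::finite) cmat set"
  assumes cvx: "convex C" and C: "\<And>R. R \<in> C \<Longrightarrow> \<exists>v. r * (norm v)\<^sup>2 < Re (qform R v)"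
  shows "\<exists>\<omega>\<in>density. \<forall>R\<in>C. r \<le> Re (trace (\<omega> ** R))"
proof (cases "C = {}")
  \<comment> \<open>Vacuous here, but this case makes the supremum infinite when no feasible
    operator exists.\<close>
  case True
  thus ?thesis using maximally_mixed_density by auto
next
  case False
  \<comment> \<open>The hypothesis on \<open>C\<close> says exactly that \<open>C\<close> misses
    this convex set; the normal vector of a separating hyperplane becomes the density.\<close>
  define T where "T = {H :: 'n cmat. \<forall>v. Re (qform H v) \<le> r * (norm v)\<^sup>2}"
  have rT: "mat (complex_of_real r) \<in> T" by (simp add: T_def qform_mat)
  have "convex T"
  proof (rule convexI)
    fix x y :: "'n cmat" and u w :: real
    assume T: "x \<in> T" "y \<in> T" and uw: "0 \<le> u" "0 \<le> w" "u + w = 1"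
    show "u *\<^sub>R x + w *\<^sub>R y \<in> T"
      unfolding T_def
    proof safe
      fix v
      have "Re (qform (u *\<^sub>R x + w *\<^sub>R y) v) \<le> u * (r * (norm v)\<^sup>2) + w * (r * (norm v)\<^sup>2)"
        using T uw by (auto simp: T_def qform_add qform_scaleR intro!: add_mono mult_left_mono)
      also have "\<dots> = r * (norm v)\<^sup>2" using uw(3) by (metis distrib_right mult_1)
      finally show "Re (qform (u *\<^sub>R x + w *\<^sub>R y) v) \<le> r * (norm v)\<^sup>2" .
    qed
  qed
  moreover have "T \<inter> C = {}" using C by (fastforce simp: T_def not_le[symmetric])
  moreover have "T \<noteq> {}" using rT by blast
  ultimately have "\<exists>a b. a \<noteq> 0 \<and> (\<forall>x\<in>T. a \<bullet> x \<le> b) \<and> (\<forall>x\<in>C. a \<bullet> x \<ge> b)"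
    using cvx False by (intro separating_hyperplane_sets)
  then obtain a b where a: "a \<noteq> 0" "\<And>x. x \<in> T \<Longrightarrow> a \<bullet> x \<le> b" "\<And>x. x \<in> C \<Longrightarrow> b \<le> a \<bullet> x"
    by blast
  have psd: "psd a"
  proof (rule inner_dual_cone_psd)
    fix Z :: "'n cmat" assume Z: "\<And>v. Re (qform Z v) \<le> 0"
    show "a \<bullet> Z \<le> 0"
    proof (rule ccontr)
      assume "\<not> a \<bullet> Z \<le> 0"
      \<comment> \<open>Large enough that moving from \<open>r\<close> times the identity by
        \<open>t\<close> in direction \<open>Z\<close>, which stays inside \<open>T\<close>,
        overshoots the bound \<open>b\<close>.\<close>
      define t where "t = (\<bar>b - a \<bullet> mat (complex_of_real r)\<bar> + 1) / (a \<bullet> Z)"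
      have t: "t > 0" using \<open>\<not> a \<bullet> Z \<le> 0\<close> by (simp add: t_def)
      have "mat (complex_of_real r) + t *\<^sub>R Z \<in> T"
        using Z t by (auto simp: T_def qform_add qform_scaleR qform_mat mult_nonneg_nonpos)
      from a(2)[OF this] have "a \<bullet> mat (complex_of_real r) + t * (a \<bullet> Z) \<le> b"
        by (simp add: inner_add_right)
      moreover have "t * (a \<bullet> Z) = \<bar>b - a \<bullet> mat (complex_of_real r)\<bar> + 1"
        using \<open>\<not> a \<bullet> Z \<le> 0\<close> by (simp add: t_def)
      ultimately show False by linarith
    qed
  qed
  define \<tau> where "\<tau> = Re (trace a)"
  \<comment> \<open>A nonzero positive semidefinite matrix has positive trace, so \<open>a\<close>
    can be normalised.\<close>
  have \<tau>: "\<tau> > 0" using psd_trace_zero[OF psd] psd_trace_nonneg[OF psd] a(1) by (force simp: \<tau>_def)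
  have inn: "a \<bullet> X = Re (trace (a ** X))" for X using psd by (simp add: inner_cmat psd_iff)
  have "r * \<tau> \<le> b"
  proof -
    have "a ** mat (complex_of_real r) = r *\<^sub>R a"
      by (simp add: vec_eq_iff matrix_matrix_mult_def mat_def if_distrib[of "\<lambda>z. _ * z"] sum.delta cong: if_cong)
         (simp add: scaleR_conv_of_real)
    thus ?thesis using a(2)[OF rT] by (simp add: inn trace_scaleR \<tau>_def)
  qed
  have "(1 / \<tau>) *\<^sub>R a \<in> density"
    using psd_scaleR[OF psd, of "1 / \<tau>"] \<tau> psd_trace_real[OF psd]
    by (auto simp: density_def trace_scaleR \<tau>_def)
  moreover have "r \<le> Re (trace (((1 / \<tau>) *\<^sub>R a) ** R))" if "R \<in> C" for R
  proof -
    have "((1 / \<tau>) *\<^sub>R a) ** R = (1 / \<tau>) *\<^sub>R (a ** R)"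
      by (simp add: vec_eq_iff matrix_matrix_mult_def scaleR_sum_right)
    moreover have "r * \<tau> \<le> Re (trace (a ** R))" using a(3)[OF that] \<open>r * \<tau> \<le> b\<close> by (simp add: inn)
    ultimately show ?thesis using \<tau> by (simp add: trace_scaleR field_simps)
  qed
  ultimately show ?thesis by blast
qed

lemma minimax_posdef_density:
  fixes C :: "('n::finite) cmat set"
  assumes cvx: "convex C" and psd: "\<And>R. R \<in> C \<Longrightarrow> psd R"
    and C: "\<And>R. R \<in> C \<Longrightarrow> \<exists>v. r * (norm v)\<^sup>2 < Re (qform R v)"
    and q: "0 < q" "q < r"
  shows "\<exists>\<omega>\<in>density. posdef \<omega> \<and> (\<forall>R\<in>C. q \<le> Re (trace (\<omega> ** R)))"
proof -
  obtain \<omega> where w: "\<omega> \<in> density" "\<And>R. R \<in> C \<Longrightarrow> r \<le> Re (trace (\<omega> ** R))"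
    using minimax_density[OF cvx C] by blast
  \<comment> \<open>The mixing weight spends exactly the gap between \<open>r\<close> and
    \<open>q\<close>; the maximally mixed part contributes a nonnegative trace.\<close>
  define t where "t = 1 - q / r"
  have t: "0 < t" "t < 1" "(1 - t) * r = q" using q by (auto simp: t_def)
  define \<mu> where "\<mu> = (1 / real CARD('n)) *\<^sub>R (mat 1 :: 'n cmat)"
  have \<mu>: "\<mu> \<in> density" unfolding \<mu>_def by (rule maximally_mixed_density)
  define \<omega>' where "\<omega>' = (1 - t) *\<^sub>R \<omega> + t *\<^sub>R \<mu>"
  have "psd \<omega>'" using w(1) \<mu> t by (auto simp: \<omega>'_def density_def intro!: psd_add psd_scaleR)
  moreover have "trace \<omega>' = 1"
    using w(1) \<mu> by (simp add: \<omega>'_def density_def trace_add trace_scaleR)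
  ultimately have "\<omega>' \<in> density" by (simp add: density_def)
  moreover have "posdef \<omega>'"
  proof -
    have "t *\<^sub>R \<mu> = mat (complex_of_real (t / real CARD('n)))"
      by (simp add: \<mu>_def vec_eq_iff mat_def) (simp add: scaleR_conv_of_real)
    thus ?thesis
      using posdef_add_mat[of "(1 - t) *\<^sub>R \<omega>" "t / real CARD('n)"] psd_scaleR[of \<omega> "1 - t"] w(1) t
      by (simp add: \<omega>'_def density_def)
  qed
  moreover have "q \<le> Re (trace (\<omega>' ** R))" if "R \<in> C" for R
  proof -
    have "\<omega>' ** R = (1 - t) *\<^sub>R (\<omega> ** R) + t *\<^sub>R (\<mu> ** R)"
      by (simp add: \<omega>'_def vec_eq_iff matrix_matrix_mult_def scaleR_sum_right algebra_simps sum.distrib sum_subtractf)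
    moreover have "0 \<le> Re (trace (\<mu> ** R))"
      using psd[OF that] \<mu> by (intro trace_psd_mult_nonneg) (auto simp: density_def)
    moreover have "(1 - t) * r \<le> (1 - t) * Re (trace (\<omega> ** R))"
      using w(2)[OF that] t by (intro mult_left_mono) auto
    ultimately show ?thesis using t by (simp add: trace_add trace_scaleR add_increasing2)
  qed
  ultimately show ?thesis by blast
qed

subsection \<open>Channels\<close>

lemma sum_UNIV_prod: "(\<Sum>p\<in>UNIV. f p) = (\<Sum>i\<in>UNIV. \<Sum>j\<in>UNIV. f (i, j))"
  using sum.cartesian_product[of "\<lambda>i j. f (i, j)" UNIV UNIV] by (simp add: case_prod_unfold)

lemma adj_kron: "adj (kron A B) = kron (adj A) (adj B)"
  by (simp add: vec_eq_iff kron_def)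

lemma kron_mult: "kron A B ** kron C D = kron (A ** C) (B ** D)"
proof -
  have "(\<Sum>p\<in>UNIV. A $ i $ fst p * B $ j $ snd p * (C $ fst p $ k * D $ snd p $ l))
    = (\<Sum>a\<in>UNIV. A $ i $ a * C $ a $ k) * (\<Sum>b\<in>UNIV. B $ j $ b * D $ b $ l)" for i j k l
    unfolding UNIV_Times_UNIV[symmetric] sum_product sum.cartesian_product
    by (intro sum.cong) (auto simp: mult_ac)
  thus ?thesis by (simp add: vec_eq_iff kron_def matrix_matrix_mult_def)
qed

lemma kron_one: "kron (mat 1) (mat 1) = mat 1"
  by (auto simp: vec_eq_iff kron_def mat_def prod_eq_iff)

lemma kron_mat_one_left:
  fixes A :: "(('x::finite) \<times> ('y::finite)) cmat"
  shows "(kron P (mat 1) ** A) $ (i, j) $ q = (\<Sum>a\<in>UNIV. P $ i $ a * A $ (a, j) $ q)"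
  by (simp add: matrix_matrix_mult_def kron_def sum_UNIV_prod mat_def if_distrib[of "\<lambda>z. _ * z"]
      if_distrib[of "\<lambda>z. z * _"] sum.delta cong: if_cong)

lemma kron_mat_one_right:
  fixes A :: "(('x::finite) \<times> ('y::finite)) cmat"
  shows "(A ** kron P (mat 1)) $ p $ (k, l) = (\<Sum>a\<in>UNIV. A $ p $ (a, l) * P $ a $ k)"
  by (simp add: matrix_matrix_mult_def kron_def sum_UNIV_prod mat_def if_distrib[of "\<lambda>z. _ * z"]
      if_distrib[of "\<lambda>z. z * _"] sum.delta cong: if_cong)

lemma ptrY_sandwich: "ptrY (kron P (mat 1) ** A ** kron P (mat 1)) = P ** ptrY A ** P"
proof -
  have "(\<Sum>j\<in>UNIV. \<Sum>b\<in>UNIV. (\<Sum>a\<in>UNIV. P $ i $ a * A $ (a, j) $ (b, j)) * P $ b $ k)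
    = (\<Sum>b\<in>UNIV. (\<Sum>a\<in>UNIV. P $ i $ a * (\<Sum>j\<in>UNIV. A $ (a, j) $ (b, j))) * P $ b $ k)" for i k
    by (subst sum.swap, simp only: sum_distrib_left sum_distrib_right)
       (subst (2) sum.swap, rule refl)
  thus ?thesis
    by (simp add: vec_eq_iff ptrY_def kron_mat_one_right kron_mat_one_left)
       (simp add: matrix_matrix_mult_def ptrY_def)
qed

lemma trace_ptrY: "trace (ptrY A) = trace A"
  by (simp add: trace_def ptrY_def sum_UNIV_prod)

lemma qform_double_sum: "qform A v = (\<Sum>i\<in>UNIV. \<Sum>j\<in>UNIV. cnj (v $ i) * A $ i $ j * v $ j)"
  by (simp add: qform_def matrix_vector_mult_def sum_distrib_left mult.assoc)

text \<open>The vector \<open>E v j\<close> is \<open>v\<close> tensored with the basis vector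
  \<open>j\<close>; the form of the partial trace at \<open>v\<close> is the sum over
  \<open>j\<close> of the forms of \<open>A\<close> at these vectors.\<close>

lemma ptrY_psd:
  fixes A :: "(('x::finite) \<times> ('y::finite)) cmat"
  assumes "psd A" shows "psd (ptrY A)"
proof -
  define E where "E = (\<lambda>v (j::'y). \<chi> p. if snd p = j then v $ (fst p :: 'x) else (0::complex))"
  have Asum: "qform A (E v j) = (\<Sum>i\<in>UNIV. \<Sum>k\<in>UNIV. cnj (v $ i) * A $ (i, j) $ (k, j) * v $ k)" for v j
  proof -
    have s: "(\<Sum>p\<in>UNIV. f p * (E v j) $ p) = (\<Sum>i\<in>UNIV. f (i, j) * v $ i)" for f
    proof -
      have "(\<Sum>p\<in>UNIV. f p * (E v j) $ p) = (\<Sum>i\<in>UNIV. \<Sum>l\<in>UNIV. f (i, l) * (if l = j then v $ i else 0))"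
        by (simp add: sum_UNIV_prod E_def cong: if_cong)
      thus ?thesis by (simp add: if_distrib[of "\<lambda>z. _ * z"] sum.delta cong: if_cong)
    qed
    have s': "(\<Sum>p\<in>UNIV. cnj ((E v j) $ p) * f p) = (\<Sum>i\<in>UNIV. cnj (v $ i) * f (i, j))" for f
    proof -
      have "(\<Sum>p\<in>UNIV. cnj ((E v j) $ p) * f p) = cnj (\<Sum>p\<in>UNIV. cnj (f p) * (E v j) $ p)"
        by (simp add: mult.commute)
      thus ?thesis unfolding s by (simp add: mult.commute)
    qed
    show ?thesis by (simp only: qform_def s') (simp add: matrix_vector_mult_def s sum_distrib_left mult.assoc)
  qed
  have "qform (ptrY A) v = (\<Sum>j\<in>UNIV. qform A (E v j))" for v
  proof -
    have "qform (ptrY A) v = (\<Sum>i\<in>UNIV. \<Sum>k\<in>UNIV. \<Sum>j\<in>UNIV. cnj (v $ i) * A $ (i, j) $ (k, j) * v $ k)"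
      by (simp add: qform_double_sum ptrY_def sum_distrib_left sum_distrib_right)
    also have "\<dots> = (\<Sum>i\<in>UNIV. \<Sum>j\<in>UNIV. \<Sum>k\<in>UNIV. cnj (v $ i) * A $ (i, j) $ (k, j) * v $ k)"
      by (intro sum.cong refl, rule sum.swap)
    also have "\<dots> = (\<Sum>j\<in>UNIV. qform A (E v j))" unfolding Asum by (rule sum.swap)
    finally show ?thesis .
  qed
  thus ?thesis using assms by (auto simp: psd_def intro!: sum_nonneg sum_in_Reals)
qed

section \<open>Positivity of Choi operators\<close>

lemma choi_nth: "choi M $ (x, y) $ (x', y') = M (eunit x x') $ y $ y'"
proof -
  have "choi M $ (x, y) $ (x', y')
    = (\<Sum>a\<in>UNIV. \<Sum>b\<in>UNIV. if x = a then (if x' = b then M (eunit a b) $ y $ y' else 0) else 0)"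
    by (simp add: choi_def kron_def) (intro sum.cong refl, auto simp: eunit_def)
  also have "\<dots> = (\<Sum>a\<in>UNIV. if x = a then M (eunit a x') $ y $ y' else 0)"
    by (intro sum.cong refl) (simp add: sum.delta')
  finally show ?thesis by (simp add: sum.delta')
qed

lemma choi_psd:
  fixes M :: "('x::finite) cmat \<Rightarrow> ('y::finite) cmat"
  assumes cp: "completely_positive M"
  shows "psd (choi M)"
proof -
  define k where "k = CARD('x)"
  \<comment> \<open>Ancilla indices are natural numbers in the definition of complete positivity, so
    the basis of the input space is enumerated.\<close>
  obtain g :: "nat \<Rightarrow> 'x" where g: "bij_betw g {..<k} UNIV"
    using ex_bij_betw_nat_finite[of "UNIV :: 'x set"] by (auto simp: k_def atLeast0LessThan)
  have inj: "g a = g b \<longleftrightarrow> a = b" if "a < k" "b < k" for a b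
    using g that by (auto simp: bij_betw_def inj_on_def)
  \<comment> \<open>The unnormalised maximally entangled operator, with its ancilla index renamed
    through \<open>g\<close>; it has rank one, so its form is the squared modulus of a linear
    functional.\<close>
  define A :: "nat \<times> 'x \<Rightarrow> nat \<times> 'x \<Rightarrow> complex"
    where "A = (\<lambda>p q. if snd p = g (fst p) \<and> snd q = g (fst q) then 1 else 0)"
  have "psd_on ({..<k} \<times> UNIV) A"
    unfolding psd_on_def
  proof
    fix v :: "nat \<times> 'x \<Rightarrow> complex"
    let ?I = "{..<k} \<times> (UNIV :: 'x set)"
    define s where "s = (\<Sum>p\<in>?I. if snd p = g (fst p) then v p else 0)"
    have "(\<Sum>p\<in>?I. \<Sum>q\<in>?I. cnj (v p) * A p q * v q)
      = (\<Sum>p\<in>?I. \<Sum>q\<in>?I. cnj (if snd p = g (fst p) then v p else 0) * (if snd q = g (fst q) then v q else 0))"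
      by (intro sum.cong refl) (simp add: A_def)
    also have "\<dots> = cnj s * s" by (simp add: s_def sum_product)
    also have "\<dots> = complex_of_real ((cmod s)\<^sup>2)" by (metis complex_norm_square mult.commute)
    finally show "(\<Sum>p\<in>?I. \<Sum>q\<in>?I. cnj (v p) * A p q * v q) \<in> \<real>
      \<and> 0 \<le> Re (\<Sum>p\<in>?I. \<Sum>q\<in>?I. cnj (v p) * A p q * v q)" by (simp only: Reals_of_real Re_complex_of_real) simp
  qed
  hence pos: "psd_on ({..<k} \<times> UNIV) (id_tensor M A)" using cp by (simp add: completely_positive_def)
  have idt: "id_tensor M A (a, y) (b, y') = choi M $ (g a, y) $ (g b, y')" for a b y y'
  proof -
    have "(\<chi> x x'. A (a, x) (b, x')) = eunit (g a) (g b)" by (simp add: vec_eq_iff A_def eunit_def)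
    thus ?thesis by (simp add: id_tensor_def choi_nth)
  qed
  have re: "(\<Sum>p\<in>{..<k} \<times> UNIV. f (g (fst p), snd p)) = (\<Sum>p\<in>UNIV. f p)" for f :: "'x \<times> 'y \<Rightarrow> complex"
  proof (rule sum.reindex_bij_betw[of "\<lambda>p. (g (fst p), snd p)" "{..<k} \<times> UNIV" UNIV f])
    show "bij_betw (\<lambda>p. (g (fst p), snd p)) ({..<k} \<times> UNIV) (UNIV :: ('x \<times> 'y) set)"
      using bij_betw_map_prod[OF g bij_betw_id[of "UNIV :: 'y set"]]
      by (simp add: map_prod_def case_prod_unfold)
  qed
  show ?thesis
    unfolding psd_def
  proof
    fix w :: "complex^('x \<times> 'y)"
    let ?I = "{..<k} \<times> (UNIV :: 'y set)"
    define v where "v = (\<lambda>p. w $ (g (fst p), snd p))"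
    have "(\<Sum>p\<in>?I. \<Sum>q\<in>?I. cnj (v p) * id_tensor M A p q * v q)
      = (\<Sum>p\<in>?I. \<Sum>q\<in>?I. cnj (w $ (g (fst p), snd p)) * choi M $ (g (fst p), snd p) $ (g (fst q), snd q) * w $ (g (fst q), snd q))"
      using idt by (auto simp: v_def intro!: sum.cong)
    also have "\<dots> = (\<Sum>p\<in>?I. \<Sum>q\<in>UNIV. cnj (w $ (g (fst p), snd p)) * choi M $ (g (fst p), snd p) $ q * w $ q)"
      by (intro sum.cong refl re)
    also have "\<dots> = (\<Sum>p\<in>UNIV. \<Sum>q\<in>UNIV. cnj (w $ p) * choi M $ p $ q * w $ q)"
      by (rule re[of "\<lambda>p. \<Sum>q\<in>UNIV. cnj (w $ p) * choi M $ p $ q * w $ q"])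
    finally show "qform (choi M) w \<in> \<real> \<and> 0 \<le> Re (qform (choi M) w)"
      using pos unfolding psd_on_def qform_double_sum by metis
  qed
qed

section \<open>The extended logarithm and suprema\<close>

definition eexp2 :: "ereal \<Rightarrow> ereal" where
  "eexp2 y = (case y of ereal r \<Rightarrow> ereal (2 powr r) | PInfty \<Rightarrow> \<infinity> | MInfty \<Rightarrow> 0)"

text \<open>A Galois connection: the conventions at nonpositive and infinite arguments match the
  values 0 and \<infinity> of \<open>eexp2\<close> at the two infinities.\<close>

lemma elog2_le_iff: "elog2 x \<le> y \<longleftrightarrow> x \<le> eexp2 y"
proof (cases x)
  case (real r)
  show ?thesis
  proof (cases "r \<le> 0")
    case True
    thus ?thesis using real by (cases y) (auto simp: elog2_def eexp2_def zero_ereal_def intro: order_trans)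
  next
    case False
    thus ?thesis using real by (cases y) (auto simp: elog2_def eexp2_def zero_ereal_def log_le_iff)
  qed
qed (cases y; auto simp: elog2_def eexp2_def)+

lemma ereal_pos_mult_le_iff:
  fixes x y :: ereal assumes "c > 0"
  shows "ereal c * x \<le> y \<longleftrightarrow> x \<le> ereal (1 / c) * y"
  using assms by (cases x; cases y) (auto simp: field_simps)

text \<open>The map is a lower adjoint and thus preserves arbitrary suprema: both sides have the
  same upper bounds, infinite values included.\<close>

lemma SUP_scaled_elog2:
  assumes "c > 0"
  shows "(SUP w\<in>S. ereal c * elog2 (f w)) = ereal c * elog2 (SUP w\<in>S. f w)"
proof -
  have "(SUP w\<in>S. ereal c * elog2 (f w)) \<le> y \<longleftrightarrow> ereal c * elog2 (SUP w\<in>S. f w) \<le> y" for y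
    by (simp add: SUP_le_iff ereal_pos_mult_le_iff[OF assms] elog2_le_iff)
  thus ?thesis by (meson order.antisym order_refl)
qed

section \<open>The two bounds for compressed pairs\<close>

lemma Qsharp_nonneg: "0 \<le> Qsharp \<alpha> \<rho> \<sigma>"
  unfolding Qsharp_def by (auto intro!: Inf_greatest psd_trace_nonneg)

lemma Qsharp_le:
  assumes "psd A" "loewner_le \<rho> (gmean (1/\<alpha>) \<sigma> A)"
  shows "Qsharp \<alpha> \<rho> \<sigma> \<le> ereal (Re (trace A))"
  unfolding Qsharp_def using assms by (intro Inf_lower) auto

context
  fixes \<omega> :: "('x::finite) cmat"
  assumes \<omega>: "psd \<omega>"
begin

lemma sandw_congruence:
  "sandw \<omega> J = kron (mpow \<omega> (1/2)) (mat 1) ** J ** adj (kron (mpow \<omega> (1/2)) (mat 1))"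
  by (simp add: sandw_def adj_kron mpow_half_psd[OF \<omega>] adj_mat)

lemma trace_sandw: "trace (sandw \<omega> A) = trace (\<omega> ** ptrY A)"
  unfolding sandw_def trace_ptrY[symmetric, of "kron _ _ ** _ ** _"] ptrY_sandwich
  by (rule trace_square_root_sandwich[OF \<omega>])

end

lemma Qsharp_sandw_le:
  assumes \<omega>: "\<omega> \<in> density" and \<alpha>: "1 < \<alpha>" and S: "psd S" and A: "psd A"
    and R: "loewner_le R (gmean (1/\<alpha>) S A)"
  shows "Qsharp \<alpha> (sandw \<omega> R) (sandw \<omega> S) \<le> ereal (opnorm (ptrY A))"
proof -
  have w: "psd \<omega>" using \<omega> by (simp add: density_def)
  note sc = sandw_congruence[OF w]
  have b: "0 < 1/\<alpha>" "1/\<alpha> < 1" using \<alpha> by auto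
  have "loewner_le (sandw \<omega> R) (gmean (1/\<alpha>) (sandw \<omega> S) (sandw \<omega> A))"
    unfolding sc by (rule loewner_le_trans[OF loewner_le_congruence[OF R] gmean_transformer[OF S A b]])
  moreover have "psd (sandw \<omega> A)" unfolding sc by (rule psd_congruence[OF A])
  ultimately have "Qsharp \<alpha> (sandw \<omega> R) (sandw \<omega> S) \<le> ereal (Re (trace (sandw \<omega> A)))" by (intro Qsharp_le)
  also have "\<dots> \<le> ereal (opnorm (ptrY A))"
    unfolding trace_sandw[OF w] using density_trace_le_opnorm[OF \<omega>] by simp
  finally show ?thesis .
qed

lemma Qsharp_sandw_ge:
  assumes \<omega>: "posdef \<omega>" and \<alpha>: "1 < \<alpha>" and S: "psd S"
    and q: "\<And>A. psd A \<Longrightarrow> loewner_le R (gmean (1/\<alpha>) S A) \<Longrightarrow> q \<le> Re (trace (\<omega> ** ptrY A))"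
  shows "ereal q \<le> Qsharp \<alpha> (sandw \<omega> R) (sandw \<omega> S)"
  unfolding Qsharp_def
proof (rule Inf_greatest, clarify)
  fix A assume A: "psd A" and le: "loewner_le (sandw \<omega> R) (gmean (1/\<alpha>) (sandw \<omega> S) A)"
  note w = posdef_psd[OF \<omega>]
  note sc = sandw_congruence[OF w]
  have b: "0 < 1/\<alpha>" "1/\<alpha> < 1" using \<alpha> by auto
  define K where "K = kron (mpow \<omega> (1/2)) (mat 1 :: 'b cmat)"
  define L where "L = kron (mpow \<omega> (-1/2)) (mat 1 :: 'b cmat)"
  note P = posdef_mpow_half[OF \<omega>]
  have K: "adj K = K" "adj L = L" "K ** L = mat 1" "L ** K = mat 1"
    using P by (simp_all add: K_def L_def adj_kron adj_mat kron_mult kron_one)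
  have inv: "L ** sandw \<omega> X ** adj L = X" for X
  proof -
    have "L ** sandw \<omega> X ** adj L = (L ** K) ** X ** (K ** L)"
      unfolding sandw_def K_def[symmetric] K(2) by (simp only: matrix_mul_assoc)
    thus ?thesis using K by simp
  qed
  \<comment> \<open>Undoing the compression: the transformer inequality with \<open>L\<close> makes
    \<open>A'\<close> feasible for \<open>R\<close> and \<open>S\<close>, and compressing
    \<open>A'\<close> returns \<open>A\<close>.\<close>
  define A' where "A' = L ** A ** adj L"
  have A': "psd A'" unfolding A'_def by (rule psd_congruence[OF A])
  have Ssan: "psd (sandw \<omega> S)" unfolding sc by (rule psd_congruence[OF S])
  have "loewner_le R (gmean (1/\<alpha>) S A')"
    using loewner_le_trans[OF loewner_le_congruence[OF le, of L] gmean_transformer[OF Ssan A b, of L]]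
    unfolding inv A'_def[symmetric] .
  from q[OF A' this] have "q \<le> Re (trace (sandw \<omega> A'))" unfolding trace_sandw[OF w] .
  also have "sandw \<omega> A' = (K ** L) ** A ** (L ** K)"
    unfolding sandw_def K_def[symmetric] A'_def K(2) by (simp only: matrix_mul_assoc)
  also have "\<dots> = A" using K by simp
  finally show "ereal q \<le> ereal (Re (trace A))" by simp
qed

text \<open>A convex combination of the two operator inequalities keeps \<open>R\<close> on the
  left, and concavity of the mean in its second argument bounds the right.\<close>

lemma convex_feasible:
  assumes S: "psd S" and \<alpha>: "1 < \<alpha>"
  shows "convex {A. psd A \<and> loewner_le R (gmean (1/\<alpha>) S A)}"
proof (rule convexI, clarify)
  fix A B and u v :: real
  assume uv: "0 \<le> u" "0 \<le> v" "u + v = 1" and A: "psd A" "loewner_le R (gmean (1/\<alpha>) S A)"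
    and B: "psd B" "loewner_le R (gmean (1/\<alpha>) S B)"
  have b: "0 < 1/\<alpha>" "1/\<alpha> < 1" using \<alpha> by auto
  have "psd (u *\<^sub>R (gmean (1/\<alpha>) S A - R) + v *\<^sub>R (gmean (1/\<alpha>) S B - R))"
    using A B uv by (auto simp: loewner_le_def intro!: psd_add psd_scaleR)
  also have "u *\<^sub>R (gmean (1/\<alpha>) S A - R) + v *\<^sub>R (gmean (1/\<alpha>) S B - R)
    = u *\<^sub>R gmean (1/\<alpha>) S A + v *\<^sub>R gmean (1/\<alpha>) S B - (u + v) *\<^sub>R R"
    by (simp add: algebra_simps)
  finally have "loewner_le R (u *\<^sub>R gmean (1/\<alpha>) S A + v *\<^sub>R gmean (1/\<alpha>) S B)"
    using uv by (simp add: loewner_le_def)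
  hence "loewner_le R (gmean (1/\<alpha>) S (u *\<^sub>R A + v *\<^sub>R B))"
    using gmean_concave_right[OF S A(1) B(1) b uv] loewner_le_trans by blast
  thus "psd (u *\<^sub>R A + v *\<^sub>R B) \<and> loewner_le R (gmean (1/\<alpha>) S (u *\<^sub>R A + v *\<^sub>R B))"
    using A B uv by (auto intro!: psd_add psd_scaleR)
qed

lemma linear_ptrY: "linear ptrY"
  by (rule linearI) (simp_all add: ptrY_def vec_eq_iff sum.distrib scaleR_sum_right)

theorem SUP_Qsharp_sandw:
  fixes R S :: "(('x::finite) \<times> ('y::finite)) cmat"
  assumes \<alpha>: "1 < \<alpha>" and S: "psd S"
  shows "(SUP \<omega>\<in>density. Qsharp \<alpha> (sandw \<omega> R) (sandw \<omega> S))
    = Inf {ereal (opnorm (ptrY A)) | A. psd A \<and> loewner_le R (gmean (1/\<alpha>) S A)}" (is "?Q = ?I")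
proof (rule antisym)
  show "?Q \<le> ?I"
    using Qsharp_sandw_le[OF _ \<alpha> S] by (auto intro!: SUP_least Inf_greatest)
  show "?I \<le> ?Q"
  proof (rule ccontr)
    assume "\<not> ?I \<le> ?Q"
    hence "?Q < ?I" by simp
    then obtain q where q: "?Q < ereal q" "ereal q < ?I" using ereal_dense2 by blast
    \<comment> \<open>Two levels are needed: the separation works at \<open>r\<close>, and the
      descent to \<open>q\<close> pays for making the density invertible.\<close>
    from ereal_dense2[OF q(2)] obtain r where r: "ereal q < ereal r" "ereal r < ?I" by blast
    have "0 \<le> ?Q"
      by (rule SUP_upper2[OF maximally_mixed_density Qsharp_nonneg])
    hence "0 < ereal q" using q(1) by (rule le_less_trans)
    hence q0: "0 < q" by simp
    define F where "F = {A. psd A \<and> loewner_le R (gmean (1/\<alpha>) S A)}"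
    have "convex (ptrY ` F)"
      unfolding F_def by (intro convex_linear_image linear_ptrY convex_feasible S \<alpha>)
    moreover have psdF: "psd X" if "X \<in> ptrY ` F" for X using that by (auto simp: F_def ptrY_psd)
    \<comment> \<open>Otherwise the norm of \<open>X\<close> would be at most \<open>r\<close>,
      which is below the infimum.\<close>
    moreover have "\<exists>v. r * (norm v)\<^sup>2 < Re (qform X v)" if X: "X \<in> ptrY ` F" for X
    proof (rule ccontr)
      assume "\<not> ?thesis"
      hence "opnorm X \<le> r" using psdF[OF X] by (intro opnorm_le) (auto simp: not_less)
      moreover have "?I \<le> ereal (opnorm X)" using X by (intro Inf_lower) (auto simp: F_def)
      ultimately have "?I \<le> ereal r" by (meson ereal_less_eq(3) order_trans)
      thus False using r(2) by (rule leD[THEN notE])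
    qed
    ultimately obtain \<omega> where w: "\<omega> \<in> density" "posdef \<omega>"
      "\<And>X. X \<in> ptrY ` F \<Longrightarrow> q \<le> Re (trace (\<omega> ** X))"
      using minimax_posdef_density[of "ptrY ` F" r q] q0 r(1) by auto
    have "ereal q \<le> Qsharp \<alpha> (sandw \<omega> R) (sandw \<omega> S)"
      using w by (intro Qsharp_sandw_ge \<alpha> S) (auto simp: F_def)
    also have "\<dots> \<le> ?Q" by (rule SUP_upper[OF w(1)])
    finally show False using q(1) by simp
  qed
qed

theorem theorem4p1:
  fixes \<alpha> :: real
    and N M :: "('x::finite) cmat \<Rightarrow> ('y::finite) cmat"
  assumes "1 < \<alpha>"
    and "completely_positive N" and "completely_positive M"
  shows "Dsharp_ch \<alpha> N M = ereal (1 / (\<alpha> - 1)) * elog2 (Qsharp_ch \<alpha> N M)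
         \<and> Qsharp_ch \<alpha> N M =
             Inf {ereal (opnorm (ptrY A)) | A. psd A \<and> loewner_le (choi N) (gmean (1/\<alpha>) (choi M) A)}"
proof
  show "Dsharp_ch \<alpha> N M = ereal (1 / (\<alpha> - 1)) * elog2 (Qsharp_ch \<alpha> N M)"
    unfolding Dsharp_ch_def chan_div_def Dsharp_def Qsharp_ch_def
    using assms(1) by (intro SUP_scaled_elog2) simp
  show "Qsharp_ch \<alpha> N M =
      Inf {ereal (opnorm (ptrY A)) | A. psd A \<and> loewner_le (choi N) (gmean (1/\<alpha>) (choi M) A)}"
    unfolding Qsharp_ch_def by (rule SUP_Qsharp_sandw[OF assms(1) choi_psd[OF assms(3)]])
qed

end
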